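(* Let $\Omega\subset\mathbb{R}^N$ be a bounded smooth domain, $s\in(0,1)$, $p\in\mathfrak{C}(\mathbb{R}^N)$ with $sp^+<N$, and let $r\in C_+(\overline{\Omega})$ satisfy $r(x)<p_s^*(x)$ for all $x\in\overline{\Omega}$. Let $g\in W^{s,p(\cdot,\cdot)}(\mathbb{R}^N)$. Then there exist positive constants $K_1=K_1(g)$ and $K_2=K_2(g)$ such that for every $h\in L^{r'(\cdot)}(\Omega)$ the unique weak solution $u\in\mathcal{K}_g(\Omega)$ of $$(-\Delta_{p(x,\cdot)})^su=h\ \text{ in }\Omega,\qquad u=g\ \text{ in }\mathbb{R}^N\setminus\Omega,$$ satisfies $$\|u\|_{r(\cdot),\Omega}^{\,p(x,y)-1}\le K_1+K_2\left(\|h\|_{r'(\cdot),\Omega}\right)^{\frac{p^+-1}{p^--1}}\quad\text{for all }(x,y)\in\mathbb{R}^N\times\mathbb{R}^N,$$ where $K_1,K_2$ are independent of $h$.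
   Context: $C_+(\overline{\Omega})$ is the set of continuous $h:\overline{\Omega}\to\mathbb{R}$ with $1<\inf_{\overline{\Omega}}h\le\sup_{\overline{\Omega}}h<\infty$; $r'$ denotes the conjugate exponent, $\frac1{r(x)}+\frac1{r'(x)}=1$. $\mathfrak{C}(\mathbb{R}^N)$ is the set of continuous symmetric functions $p:\mathbb{R}^N\times\mathbb{R}^N\to\mathbb{R}$ (i.e. $p(x,y)=p(y,x)$) with $1<p^-:=\inf p\le p^+:=\sup p<\infty$ (inf and sup over $\mathbb{R}^N\times\mathbb{R}^N$). Write $\overline{p}(x)=p(x,x)$ and $p_s^*(x)=\frac{N\overline{p}(x)}{N-s\overline{p}(x)}$. For a measurable exponent $q$ on an open set $U$, $L^{q(\cdot)}(U)$ is the space of measurable $u:U\to\mathbb{R}$ with $\int_U|u|^{q(x)}dx<\infty$, with Luxemburg norm $\|u\|_{q(\cdot),U}=\inf\{\lambda>0:\int_U|u/\lambda|^{q(x)}dx\le1\}$. $W^{s,p(\cdot,\cdot)}(\mathbb{R}^N)$ is the set of $u\in L^{\overline{p}(\cdot)}(\mathbb{R}^N)$ with $\int_{\mathbb{R}^N}\int_{\mathbb{R}^N}\frac{|u(x)-u(y)|^{p(x,y)}}{|x-y|^{N+sp(x,y)}}dxdy<\infty$. $W_0^{s,p(\cdot,\cdot)}(\Omega)=\{u\in W^{s,p(\cdot,\cdot)}(\mathbb{R}^N):u=0\text{ on }\mathbb{R}^N\setminus\Omega\}$ and $\mathcal{K}_g(\Omega)=\{u\in W^{s,p(\cdot,\cdot)}(\mathbb{R}^N):u-g\in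 W_0^{s,p(\cdot,\cdot)}(\Omega)\}$. A weak solution of the problem is a function $u\in\mathcal{K}_g(\Omega)$ with $\langle\mathcal{L}(u),\varphi\rangle=\int_\Omega h\varphi\,dx$ for all $\varphi\in W_0^{s,p(\cdot,\cdot)}(\Omega)$, where $\langle\mathcal{L}(u),\varphi\rangle=\int_{\mathbb{R}^N}\int_{\mathbb{R}^N}\frac{|u(x)-u(y)|^{p(x,y)-2}(u(x)-u(y))(\varphi(x)-\varphi(y))}{|x-y|^{N+sp(x,y)}}dxdy$. Under the stated hypotheses a weak solution exists and is unique. *)

theory Defs
  imports "HOL-Analysis.Analysis"
begin

text \<open>The Euclidean space \<open>\<real>\<^sup>N\<close> is rendered as a type of class \<^class>\<open>euclidean_space\<close>
  with \<open>N = DIM('a)\<close>. Elements of the function spaces are Lebesgue measurable functions rather than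
  equivalence classes, so pointwise conditions on them are required almost everywhere.\<close>

primrec Ck_fun :: "nat \<Rightarrow> ('a::euclidean_space \<Rightarrow> real) \<Rightarrow> bool" where
  "Ck_fun 0 f \<longleftrightarrow> continuous_on UNIV f"
| "Ck_fun (Suc k) f \<longleftrightarrow>
     f differentiable_on UNIV \<and> (\<forall>v. Ck_fun k (\<lambda>x. frechet_derivative f (at x) v))"

definition smooth_fun :: "('a::euclidean_space \<Rightarrow> real) \<Rightarrow> bool" where
  "smooth_fun f \<longleftrightarrow> (\<forall>k. Ck_fun k f)"

text \<open>Near each boundary point, \<open>\<Omega>\<close> is the region above the graph of a smooth function \<open>\<gamma>\<close> over the
  hyperplane orthogonal to a unit vector \<open>e\<close>, which plays the role of the last coordinate axis.
  Only the values of \<open>\<gamma>\<close> on that hyperplane matter; a smooth function on the hyperplane extends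
  smoothly to the whole space by composition with the orthogonal projection.\<close>

definition smooth_boundary :: "'a::euclidean_space set \<Rightarrow> bool" where
  "smooth_boundary \<Omega> \<longleftrightarrow>
     (\<forall>z\<in>frontier \<Omega>. \<exists>\<rho>>0. \<exists>e \<gamma>. norm e = 1 \<and> smooth_fun \<gamma> \<and>
        \<Omega> \<inter> ball z \<rho> = {x \<in> ball z \<rho>. x \<bullet> e > \<gamma> (x - (x \<bullet> e) *\<^sub>R e)})"

definition bounded_smooth_domain :: "'a::euclidean_space set \<Rightarrow> bool" where
  "bounded_smooth_domain \<Omega> \<longleftrightarrow>
     \<Omega> \<noteq> {} \<and> open \<Omega> \<and> connected \<Omega> \<and> bounded \<Omega> \<and> smooth_boundary \<Omega>"

definition C_plus :: "'a::euclidean_space set \<Rightarrow> ('a \<Rightarrow> real) set" where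
  "C_plus S = {h. continuous_on S h \<and> bdd_below (h ` S) \<and> bdd_above (h ` S) \<and> 1 < Inf (h ` S)}"

definition conj_exponent :: "('a \<Rightarrow> real) \<Rightarrow> 'a \<Rightarrow> real" where
  "conj_exponent r x = r x / (r x - 1)"

lemma conj_exponent_eq: "r x > 1 \<Longrightarrow> 1 / r x + 1 / conj_exponent r x = 1"
  by (simp add: conj_exponent_def field_simps)

definition exp_inf :: "('a \<Rightarrow> 'a \<Rightarrow> real) \<Rightarrow> real" where
  "exp_inf p = (INF (x, y)\<in>UNIV. p x y)"

definition exp_sup :: "('a \<Rightarrow> 'a \<Rightarrow> real) \<Rightarrow> real" where
  "exp_sup p = (SUP (x, y)\<in>UNIV. p x y)"

definition sym_exponents :: "('a::euclidean_space \<Rightarrow> 'a \<Rightarrow> real) set" where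
  "sym_exponents = {p. continuous_on UNIV (\<lambda>(x, y). p x y) \<and> (\<forall>x y. p x y = p y x) \<and>
     bdd_below (range (\<lambda>(x, y). p x y)) \<and> bdd_above (range (\<lambda>(x, y). p x y)) \<and> 1 < exp_inf p}"

definition diag_exp :: "('a \<Rightarrow> 'a \<Rightarrow> real) \<Rightarrow> 'a \<Rightarrow> real" where
  "diag_exp p x = p x x"

definition crit_exp :: "real \<Rightarrow> ('a::euclidean_space \<Rightarrow> 'a \<Rightarrow> real) \<Rightarrow> 'a \<Rightarrow> real" where
  "crit_exp s p x = real DIM('a) * diag_exp p x / (real DIM('a) - s * diag_exp p x)"

definition Lvar :: "('a::euclidean_space \<Rightarrow> real) \<Rightarrow> 'a set \<Rightarrow> ('a \<Rightarrow> real) set" where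
  "Lvar q U = {u \<in> borel_measurable (lebesgue_on U).
     (\<integral>\<^sup>+x. ennreal (\<bar>u x\<bar> powr q x) \<partial>lebesgue_on U) < \<infinity>}"

text \<open>For \<open>u\<close> in \<open>Lvar q U\<close> with \<open>q\<close> bounded, the set below is nonempty; otherwise the real-valued
  infimum may be that of the empty set and carry no information.\<close>

definition lux_norm :: "('a::euclidean_space \<Rightarrow> real) \<Rightarrow> 'a set \<Rightarrow> ('a \<Rightarrow> real) \<Rightarrow> real" where
  "lux_norm q U u =
     Inf {l. l > 0 \<and> (\<integral>\<^sup>+x. ennreal (\<bar>u x / l\<bar> powr q x) \<partial>lebesgue_on U) \<le> 1}"

definition Wsp :: "real \<Rightarrow> ('a::euclidean_space \<Rightarrow> 'a \<Rightarrow> real) \<Rightarrow> ('a \<Rightarrow> real) set" where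
  "Wsp s p = {u \<in> Lvar (diag_exp p) UNIV.
     (\<integral>\<^sup>+(x, y). ennreal (\<bar>u x - u y\<bar> powr p x y / norm (x - y) powr (real DIM('a) + s * p x y))
        \<partial>(lebesgue \<Otimes>\<^sub>M lebesgue)) < \<infinity>}"

definition W0sp :: "real \<Rightarrow> ('a::euclidean_space \<Rightarrow> 'a \<Rightarrow> real) \<Rightarrow> 'a set \<Rightarrow> ('a \<Rightarrow> real) set" where
  "W0sp s p \<Omega> = {u \<in> Wsp s p. AE x in lebesgue. x \<notin> \<Omega> \<longrightarrow> u x = 0}"

definition Kg :: "real \<Rightarrow> ('a::euclidean_space \<Rightarrow> 'a \<Rightarrow> real) \<Rightarrow> 'a set \<Rightarrow> ('a \<Rightarrow> real) \<Rightarrow>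
    ('a \<Rightarrow> real) set" where
  "Kg s p \<Omega> g = {u \<in> Wsp s p. (\<lambda>x. u x - g x) \<in> W0sp s p \<Omega>}"

definition pairing :: "real \<Rightarrow> ('a::euclidean_space \<Rightarrow> 'a \<Rightarrow> real) \<Rightarrow> ('a \<Rightarrow> real) \<Rightarrow> ('a \<Rightarrow> real) \<Rightarrow>
    real" where
  "pairing s p u \<phi> =
     (\<integral>(x, y). \<bar>u x - u y\<bar> powr (p x y - 2) * (u x - u y) * (\<phi> x - \<phi> y) /
        norm (x - y) powr (real DIM('a) + s * p x y) \<partial>(lebesgue \<Otimes>\<^sub>M lebesgue))"

definition weak_solution :: "real \<Rightarrow> ('a::euclidean_space \<Rightarrow> 'a \<Rightarrow> real) \<Rightarrow> 'a set \<Rightarrow> ('a \<Rightarrow> real) \<Rightarrow>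
    ('a \<Rightarrow> real) \<Rightarrow> ('a \<Rightarrow> real) \<Rightarrow> bool" where
  "weak_solution s p \<Omega> g h u \<longleftrightarrow> u \<in> Kg s p \<Omega> g \<and>
     (\<forall>\<phi>\<in>W0sp s p \<Omega>. pairing s p u \<phi> = (\<integral>x. h x * \<phi> x \<partial>lebesgue_on \<Omega>))"

end

theory Submission
  imports Defs
begin

text \<open>Write \<open>v = u - g\<close> and let \<open>M\<close> be the Gagliardo modular. Testing the equation with \<open>v\<close> and
  absorbing by Young's inequality bounds \<open>M v\<close> by a constant depending on \<open>g\<close> plus a multiple of
  \<open>\<integral> h v\<close>, hence of the product of the norms of \<open>h\<close> and \<open>v\<close>. The embedding bounds the norm of \<open>v\<close>
  by \<open>\<sigma> = max 1 (M v powr (1/p\<^sup>-))\<close>, so that \<open>\<sigma> powr (p\<^sup>- - 1)\<close> is at most affine in the norm of \<open>h\<close>.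

  The embedding is proved through level sets \<open>A\<^sub>l = {\<bar>u\<bar> > l}\<close> inside a cube so small that \<open>p \<ge> q\<close>
  on it, with \<open>r\<close> below the critical exponent of the constant \<open>q\<close>. The modular controls the
  interaction of \<open>A\<^sub>2\<^sub>l\<close> with the nearby complement of \<open>A\<^sub>l\<close>, which yields
  \<open>\<bar>A\<^sub>2\<^sub>l\<bar> \<le> C M l\<^sup>-\<^sup>q \<bar>A\<^sub>l\<bar> powr (s q / N)\<close>; iterating over dyadic \<open>l\<close> gives the weak-type bound with the
  critical exponent \<open>N q / (N - s q)\<close>. For \<open>v\<close> vanishing outside \<open>\<Omega>\<close> the iteration is started by the
  interaction of \<open>A\<^sub>l\<close> with a ball outside \<open>\<Omega>\<close>.\<close>

section \<open>The Gagliardo modular and measurability on the product space\<close>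

definition gagliardo_integrand ::
    "real \<Rightarrow> ('a::euclidean_space \<Rightarrow> 'a \<Rightarrow> real) \<Rightarrow> ('a \<Rightarrow> real) \<Rightarrow> 'a \<times> 'a \<Rightarrow> real" where
  "gagliardo_integrand s p u = (\<lambda>(x, y). \<bar>u x - u y\<bar> powr p x y /
     norm (x - y) powr (real DIM('a) + s * p x y))"

text \<open>Valued in \<open>ennreal\<close>, so that Tonelli and pointwise comparison apply before
  finiteness is known. On the diagonal the integrand is 0 / 0 = 0.\<close>

definition gagliardo_modular ::
    "real \<Rightarrow> ('a::euclidean_space \<Rightarrow> 'a \<Rightarrow> real) \<Rightarrow> ('a \<Rightarrow> real) \<Rightarrow> ennreal" where
  "gagliardo_modular s p u =
     (\<integral>\<^sup>+z. ennreal (gagliardo_integrand s p u z) \<partial>(lebesgue \<Otimes>\<^sub>M lebesgue))"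

text \<open>Completion changes no measure of a Borel set, so a countable cover for
  \<open>lborel\<close> still works. Tonelli on the product of two copies of \<open>lebesgue\<close>
  rests on this.\<close>

lemma sigma_finite_lebesgue: "sigma_finite_measure (lebesgue :: 'a::euclidean_space measure)"
proof
  obtain A :: "'a set set" where "countable A" "A \<subseteq> sets lborel" "\<Union>A = space lborel"
      "\<forall>a\<in>A. emeasure lborel a \<noteq> \<infinity>"
    using lborel.sigma_finite_countable by auto
  then show "\<exists>A. countable A \<and> A \<subseteq> sets lebesgue \<and> \<Union>A = space (lebesgue :: 'a measure) \<and>
      (\<forall>a\<in>A. emeasure lebesgue a \<noteq> \<infinity>)"
    by (intro exI[of _ A]) auto
qed

lemma id_measurable_lebesgue_borel: "(\<lambda>x. x) \<in> lebesgue \<rightarrow>\<^sub>M borel"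
  by (simp add: measurable_completion)

text \<open>The identity is measurable from the product of the completed spaces to the product of
  the Borel spaces, so Borel functions pull back. This covers the exponent and the kernel; functions
  such as \<open>u\<close> enter through the projections.\<close>

lemma borel_pair_measurable_lebesgue:
  fixes f :: "'a::euclidean_space \<times> 'a \<Rightarrow> real"
  assumes "f \<in> borel_measurable borel"
  shows "f \<in> borel_measurable (lebesgue \<Otimes>\<^sub>M lebesgue)"
proof -
  have "(\<lambda>z. z) \<in> (lebesgue \<Otimes>\<^sub>M lebesgue) \<rightarrow>\<^sub>M (borel \<Otimes>\<^sub>M (borel :: 'a measure))"
    using measurable_compose[OF measurable_fst id_measurable_lebesgue_borel]
      measurable_compose[OF measurable_snd id_measurable_lebesgue_borel]
    by (intro measurable_pair) (auto simp: comp_def)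
  from measurable_compose[OF this, of f borel] show ?thesis
    using assms by (simp add: borel_prod)
qed

lemma diff_measurable_pair_lebesgue:
  fixes u :: "'a::euclidean_space \<Rightarrow> real"
  assumes "u \<in> borel_measurable lebesgue"
  shows "(\<lambda>z. u (fst z) - u (snd z)) \<in> borel_measurable (lebesgue \<Otimes>\<^sub>M lebesgue)"
  using measurable_compose[OF measurable_fst assms] measurable_compose[OF measurable_snd assms]
  by (intro borel_measurable_diff) auto

lemma exponent_measurable_pair_lebesgue:
  fixes p :: "'a::euclidean_space \<Rightarrow> 'a \<Rightarrow> real"
  assumes "continuous_on UNIV (\<lambda>(x, y). p x y)"
  shows "(\<lambda>z. p (fst z) (snd z)) \<in> borel_measurable (lebesgue \<Otimes>\<^sub>M lebesgue)"
  by (rule borel_pair_measurable_lebesgue, rule borel_measurable_continuous_onI)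
    (use assms in \<open>simp add: split_beta\<close>)

lemma norm_diff_measurable_pair_lebesgue:
  "(\<lambda>z. norm (fst z - snd z)) \<in>
     borel_measurable (lebesgue \<Otimes>\<^sub>M (lebesgue :: 'a::euclidean_space measure))"
  by (rule borel_pair_measurable_lebesgue, rule borel_measurable_continuous_onI)
    (intro continuous_intros)

lemma gagliardo_integrand_measurable:
  assumes "continuous_on UNIV (\<lambda>(x, y). p x y)" "u \<in> borel_measurable lebesgue"
  shows "gagliardo_integrand s p u \<in> borel_measurable (lebesgue \<Otimes>\<^sub>M lebesgue)"
proof -
  note [measurable] = exponent_measurable_pair_lebesgue[OF assms(1)]
    diff_measurable_pair_lebesgue[OF assms(2)] norm_diff_measurable_pair_lebesgue
  show ?thesis
    unfolding gagliardo_integrand_def split_beta by measurable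
qed

lemma gagliardo_integrand_nonneg: "gagliardo_integrand s p u z \<ge> 0"
  by (simp add: gagliardo_integrand_def split_beta)

text \<open>By Tonelli it is enough that each inner integral over \<open>y\<close> is at least
  \<open>c * m\<close> for \<open>x\<close> in \<open>A\<close>. The set \<open>S\<close> may vary
  with \<open>x\<close> arbitrarily, because only the value of the inner integral is
  bounded.\<close>

lemma nn_integral_pair_lower_bound:
  fixes f :: "'a::euclidean_space \<times> 'a \<Rightarrow> ennreal"
  assumes f: "f \<in> borel_measurable (lebesgue \<Otimes>\<^sub>M lebesgue)" and A: "A \<in> sets lebesgue"
    and S: "\<And>x. x \<in> A \<Longrightarrow> \<exists>S\<in>sets lebesgue. m \<le> emeasure lebesgue S \<and>
              (AE y in lebesgue. y \<in> S \<longrightarrow> c \<le> f (x, y))"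
  shows "c * m * emeasure lebesgue A \<le> (\<integral>\<^sup>+z. f z \<partial>(lebesgue \<Otimes>\<^sub>M lebesgue))"
proof -
  have "c * m * indicator A x \<le> (\<integral>\<^sup>+y. f (x, y) \<partial>lebesgue)" for x
  proof (cases "x \<in> A")
    case True
    then obtain S where S: "S \<in> sets lebesgue" "m \<le> emeasure lebesgue S"
        "AE y in lebesgue. y \<in> S \<longrightarrow> c \<le> f (x, y)"
      using assms(3) by blast
    have "c * m \<le> c * emeasure lebesgue S"
      using S(2) by (intro mult_left_mono) auto
    also have "\<dots> = (\<integral>\<^sup>+y. c * indicator S y \<partial>lebesgue)"
      using S(1) by (simp add: nn_integral_cmult_indicator)
    also have "\<dots> \<le> (\<integral>\<^sup>+y. f (x, y) \<partial>lebesgue)"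
      using S(3) by (intro nn_integral_mono_AE) (auto split: split_indicator)
    finally show ?thesis using True by simp
  qed simp
  then have "(\<integral>\<^sup>+x. c * m * indicator A x \<partial>lebesgue) \<le> (\<integral>\<^sup>+x. \<integral>\<^sup>+y. f (x, y) \<partial>lebesgue \<partial>lebesgue)"
    by (intro nn_integral_mono) auto
  then show ?thesis
    using A by (simp add: nn_integral_cmult_indicator
        sigma_finite_measure.nn_integral_fst[OF sigma_finite_lebesgue f])
qed

lemma cube_contains_subcube:
  fixes a x :: "'a::euclidean_space"
  assumes "x \<in> cbox a (a + L *\<^sub>R One)" "0 \<le> R" "R \<le> L"
  obtains c where "x \<in> cbox c (c + R *\<^sub>R One)" "cbox c (c + R *\<^sub>R One) \<subseteq> cbox a (a + L *\<^sub>R One)"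
proof -
  \<comment> \<open>In each coordinate the small cube is pushed down until it ends at
    \<open>x\<close>, or until it meets the lower face of the large cube.\<close>
  define c where "c = (\<Sum>i\<in>Basis. max (a \<bullet> i) (x \<bullet> i - R) *\<^sub>R i)"
  have c: "c \<bullet> i = max (a \<bullet> i) (x \<bullet> i - R)" if "i \<in> Basis" for i
    using that by (simp add: c_def)
  have "x \<in> cbox c (c + R *\<^sub>R One)" "cbox c (c + R *\<^sub>R One) \<subseteq> cbox a (a + L *\<^sub>R One)"
    using assms by (fastforce simp: mem_box c inner_add_left)+
  then show ?thesis by (rule that)
qed

lemma norm_diff_le_cube:
  fixes x y :: "'a::euclidean_space"
  assumes "x \<in> cbox a (a + L *\<^sub>R One)" "y \<in> cbox a (a + L *\<^sub>R One)"
  shows "norm (x - y) \<le> real DIM('a) * L"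
proof -
  have "norm (x - y) \<le> (\<Sum>i\<in>Basis. \<bar>(x - y) \<bullet> i\<bar>)"
    by (rule norm_le_l1)
  also have "\<dots> \<le> (\<Sum>i\<in>(Basis :: 'a set). L)"
  proof (rule sum_mono)
    fix i :: 'a assume i: "i \<in> Basis"
    have "a \<bullet> i \<le> x \<bullet> i" "x \<bullet> i \<le> a \<bullet> i + L" "a \<bullet> i \<le> y \<bullet> i" "y \<bullet> i \<le> a \<bullet> i + L"
      using assms i by (auto simp: mem_box inner_add_left)
    then show "\<bar>(x - y) \<bullet> i\<bar> \<le> L" by (simp add: inner_diff_left)
  qed
  finally show ?thesis by simp
qed

section \<open>Level sets on small cubes\<close>

lemma level_set_lmeasurable:
  fixes u :: "'a::euclidean_space \<Rightarrow> real"
  assumes u: "u \<in> borel_measurable lebesgue" and Q: "Q \<in> lmeasurable"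
  shows "{x \<in> Q. t < \<bar>u x\<bar>} \<in> lmeasurable"
proof -
  have "{x \<in> space lebesgue. t < \<bar>u x\<bar>} \<in> sets lebesgue" using u by measurable
  then have "Q \<inter> {x. t < \<bar>u x\<bar>} \<in> lmeasurable"
    using Q by (intro fmeasurable_Int_fmeasurable) simp_all
  moreover have "{x \<in> Q. t < \<bar>u x\<bar>} = Q \<inter> {x. t < \<bar>u x\<bar>}" by auto
  ultimately show ?thesis by simp
qed

text \<open>On a cube of diameter at most 1 every point with \<open>\<bar>u\<bar> > 2 l\<close> sees, at distance comparable to
  the side of a cube of volume \<open>2 \<bar>A\<bar>\<close>, a set of measure \<open>\<bar>A\<bar>\<close> on which \<open>\<bar>u\<bar> \<le> l\<close>.\<close>

lemma level_set_decay:
  fixes p :: "'a::euclidean_space \<Rightarrow> 'a \<Rightarrow> real" and a :: 'a and L :: real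
  defines "Q \<equiv> cbox a (a + L *\<^sub>R One)"
  assumes p: "continuous_on UNIV (\<lambda>(x, y). p x y)" and u: "u \<in> borel_measurable lebesgue"
    and L: "0 < L" "real DIM('a) * L \<le> 1"
    and q: "\<And>x y. x \<in> Q \<Longrightarrow> y \<in> Q \<Longrightarrow> q \<le> p x y" "0 < q" and s: "0 < s"
    and M: "gagliardo_modular s p u \<le> ennreal M" "0 \<le> M" and l: "1 \<le> l"
    and small: "2 * measure lebesgue {x \<in> Q. l < \<bar>u x\<bar>} \<le> L ^ DIM('a)"
  shows "measure lebesgue {x \<in> Q. 2 * l < \<bar>u x\<bar>} \<le>
    real DIM('a) powr (real DIM('a) + s * q) * 2 powr (1 + s * q / real DIM('a)) * M * l powr (- q) *
    measure lebesgue {x \<in> Q. l < \<bar>u x\<bar>} powr (s * q / real DIM('a))"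
proof -
  define N where "N = real DIM('a)"
  define A where "A = {x \<in> Q. l < \<bar>u x\<bar>}"
  define B where "B = {x \<in> Q. 2 * l < \<bar>u x\<bar>}"
  have N: "N \<ge> 1" unfolding N_def using DIM_positive[where 'a='a] by linarith
  have Q: "Q \<in> lmeasurable" by (simp add: Q_def)
  have A: "A \<in> lmeasurable" and B: "B \<in> lmeasurable"
    using level_set_lmeasurable[OF u Q] by (auto simp: A_def B_def)
  have BA: "B \<subseteq> A" using l by (auto simp: A_def B_def)
  show ?thesis
  proof (cases "measure lebesgue A = 0")
    case True
    then have "measure lebesgue B = 0"
      using measure_mono_fmeasurable[OF BA fmeasurableD[OF B] A] measure_nonneg[of lebesgue B]
      by linarith
    then show ?thesis using True by (simp add: A_def B_def)
  next
    case False
    define m where "m = measure lebesgue A"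
    have m: "m > 0" using False by (simp add: m_def zero_less_measure_iff)
    \<comment> \<open>Side of a cube of volume \<open>2 * m\<close>: since \<open>A\<close> has
      measure \<open>m\<close>, at least half of any such cube lies outside \<open>A\<close>. The
      hypothesis \<open>small\<close> says exactly that this cube fits into
      \<open>Q\<close>.\<close>
    define R where "R = (2 * m) powr (1 / N)"
    have R: "R > 0" using m by (simp add: R_def)
    have RN: "R powr N = 2 * m" using m N by (simp add: R_def powr_powr)
    have RN': "R ^ DIM('a) = 2 * m" using RN R by (simp add: N_def powr_realpow)
    have RL: "R \<le> L"
    proof (rule ccontr)
      assume "\<not> R \<le> L"
      then have "L ^ DIM('a) < R ^ DIM('a)" using L by (intro power_strict_mono) auto
      with small RN' show False by (simp add: m_def A_def)
    qed
    have NR: "N * R \<le> 1" using L N mult_left_mono[OF RL, of N] by (fold N_def) linarith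
    \<comment> \<open>Lower bound for the integrand: the difference of values contributes
      \<open>l powr q\<close>, and the distance is at most \<open>N * R\<close>.\<close>
    define c where "c = l powr q * (N * R) powr (- (N + s * q))"
    have "ennreal c * ennreal m * emeasure lebesgue B \<le> gagliardo_modular s p u"
      unfolding gagliardo_modular_def
    proof (rule nn_integral_pair_lower_bound)
      show "(\<lambda>z. ennreal (gagliardo_integrand s p u z)) \<in> borel_measurable (lebesgue \<Otimes>\<^sub>M lebesgue)"
        using gagliardo_integrand_measurable[OF p u] by measurable
      show "B \<in> sets lebesgue" using B by (simp add: fmeasurableD)
      fix x assume x: "x \<in> B"
      then have xQ: "x \<in> cbox a (a + L *\<^sub>R One)" by (simp add: B_def Q_def)
      obtain d where d: "x \<in> cbox d (d + R *\<^sub>R One)" "cbox d (d + R *\<^sub>R One) \<subseteq> Q"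
        using cube_contains_subcube[OF xQ _ RL] R by (metis Q_def less_imp_le)
      define C where "C = cbox d (d + R *\<^sub>R One)"
      have C: "C \<in> lmeasurable" by (simp add: C_def)
      have mC: "measure lebesgue C = 2 * m"
        using R RN' by (simp add: C_def content_cbox_plus)
      have "measure lebesgue (C - A) \<ge> m"
        using measure_diff_le_measure_setdiff[OF C A] mC by (simp add: m_def)
      moreover have "emeasure lebesgue (C - A) = ennreal (measure lebesgue (C - A))"
        using A C by (intro emeasure_eq_measure2 fmeasurable.Diff)
      moreover have "ennreal c \<le> ennreal (gagliardo_integrand s p u (x, y))" if y: "y \<in> C - A" for y
      proof -
        have yQ: "y \<in> Q" using y d by (auto simp: C_def)
        have ul: "l \<le> \<bar>u x - u y\<bar>" and "u x \<noteq> u y"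
          using x y yQ l by (auto simp: A_def B_def)
        then have xy: "norm (x - y) > 0" by auto
        have dist: "norm (x - y) \<le> N * R"
          using norm_diff_le_cube[OF d(1)] y by (simp add: C_def N_def)
        have qp: "q \<le> p x y" using q(1) xQ yQ by (simp add: Q_def)
        have "(N * R) powr (- (N + s * q)) \<le> norm (x - y) powr (- (N + s * q))"
          using dist xy N mult_pos_pos[OF s q(2)] by (intro powr_mono2') auto
        \<comment> \<open>Distances are at most 1 here, so enlarging the exponent from
          \<open>q\<close> to \<open>p x y\<close> only enlarges the kernel.\<close>
        also have "\<dots> \<le> norm (x - y) powr (- (N + s * p x y))"
          using dist xy NR qp s by (intro powr_mono') auto
        finally have 1: "(N * R) powr (- (N + s * q)) \<le> norm (x - y) powr (- (N + s * p x y))" .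
        have "l powr q \<le> l powr p x y" using l qp by (intro powr_mono) auto
        also have "\<dots> \<le> \<bar>u x - u y\<bar> powr p x y" using ul l qp q(2) by (intro powr_mono2) auto
        finally have "c \<le> \<bar>u x - u y\<bar> powr p x y * norm (x - y) powr (- (N + s * p x y))"
          unfolding c_def using 1 by (intro mult_mono) auto
        also have "\<dots> = gagliardo_integrand s p u (x, y)"
          unfolding gagliardo_integrand_def prod.case N_def[symmetric]
          by (subst powr_minus) (simp add: divide_inverse)
        finally show ?thesis by (rule ennreal_leI)
      qed
      ultimately show "\<exists>S\<in>sets lebesgue. ennreal m \<le> emeasure lebesgue S \<and>
          (AE y in lebesgue. y \<in> S \<longrightarrow> ennreal c \<le> ennreal (gagliardo_integrand s p u (x, y)))"
        using A C by (intro bexI[of _ "C - A"]) (auto simp: fmeasurableD)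
    qed
    also have "\<dots> \<le> ennreal M" by (rule M)
    finally have "ennreal (c * m * measure lebesgue B) \<le> ennreal M"
      using B m by (simp add: emeasure_eq_measure2 ennreal_mult' c_def)
    then have *: "c * m * measure lebesgue B \<le> M" using M(2) by simp
    have c0: "c * m > 0" using l m R N by (simp add: c_def)
    have "measure lebesgue B \<le> M / (c * m)" using * c0 by (simp add: field_simps)
    also have "M / (c * m) = N powr (N + s * q) * 2 powr (1 + s * q / N) * M * l powr (- q) * m powr (s * q / N)"
    proof -
      have "R powr (N + s * q) = (2 * m) powr (1 + s * q / N)"
        using N m by (simp add: R_def powr_powr add_divide_distrib)
      also have "\<dots> = 2 powr (1 + s * q / N) * (m * m powr (s * q / N))"
        using m by (simp add: powr_mult powr_add)
      finally have "(N * R) powr (N + s * q) = N powr (N + s * q) * (2 powr (1 + s * q / N) * (m * m powr (s * q / N)))"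
        using N R by (simp add: powr_mult)
      moreover have "M / (c * m) = M * l powr (- q) * (N * R) powr (N + s * q) / m"
        unfolding c_def powr_minus by (simp add: divide_inverse mult_ac)
      ultimately have "M / (c * m) = M * l powr (- q) *
          (N powr (N + s * q) * (2 powr (1 + s * q / N) * (m * m powr (s * q / N)))) / m"
        by simp
      then show ?thesis using m by (simp add: field_simps)
    qed
    finally show ?thesis by (simp add: m_def A_def B_def N_def)
  qed
qed

text \<open>The decay rate \<sigma> = q / (1 - \<theta>) is the fixed point of \<sigma> = q +
  \<sigma> \<theta>, so the recursion reproduces the geometric profile. The condition on
  \<open>D\<close> absorbs \<open>K\<close> together with the loss of one dyadic step.\<close>

lemma geometric_decay_of_recursion:
  fixes a :: "nat \<Rightarrow> real"
  assumes nonneg: "\<And>k. 0 \<le> a k" and "a 0 \<le> D" "0 < D" "0 \<le> K"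
    and \<theta>: "0 \<le> \<theta>" "\<theta> < 1" and D: "K * 2 powr (q / (1 - \<theta>)) \<le> D powr (1 - \<theta>)"
    and step: "\<And>k. a (Suc k) \<le> K * 2 powr (- q * real k) * a k powr \<theta>"
  shows "a k \<le> D * 2 powr (- (q / (1 - \<theta>)) * real k)"
proof (induction k)
  case 0
  then show ?case using assms by simp
next
  case (Suc k)
  define \<sigma> where "\<sigma> = q / (1 - \<theta>)"
  have \<sigma>: "q + \<sigma> * \<theta> = \<sigma>" using \<theta> by (simp add: \<sigma>_def field_simps)
  have "a k powr \<theta> \<le> (D * 2 powr (- \<sigma> * real k)) powr \<theta>"
    using Suc \<theta> nonneg by (intro powr_mono2) (auto simp: \<sigma>_def)
  also have "\<dots> = D powr \<theta> * 2 powr (- \<sigma> * \<theta> * real k)"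
    using \<open>0 < D\<close> by (simp add: powr_mult powr_powr mult.assoc mult.left_commute mult.commute)
  finally have "a (Suc k) \<le> K * 2 powr (- q * real k) * (D powr \<theta> * 2 powr (- \<sigma> * \<theta> * real k))"
    using step[of k] \<open>0 \<le> K\<close> by (meson mult_left_mono mult_nonneg_nonneg order_trans powr_ge_zero)
  also have "\<dots> = K * D powr \<theta> * 2 powr (- (q + \<sigma> * \<theta>) * real k)"
    by (simp add: powr_add[symmetric] algebra_simps)
  also have "\<dots> = (K * 2 powr \<sigma>) * (D powr \<theta> * 2 powr (- \<sigma> * real (Suc k)))"
    unfolding \<sigma> by (simp add: powr_add[symmetric] powr_diff powr_minus algebra_simps divide_inverse)
  also have "\<dots> \<le> D powr (1 - \<theta>) * (D powr \<theta> * 2 powr (- \<sigma> * real (Suc k)))"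
    using D by (intro mult_right_mono) (auto simp: \<sigma>_def)
  also have "\<dots> = D * 2 powr (- \<sigma> * real (Suc k))"
    using \<open>0 < D\<close> by (simp add: mult.assoc[symmetric] powr_add[symmetric])
  finally show ?case by (simp add: \<sigma>_def)
qed

lemma dyadic_exponent_exists:
  fixes t l :: real
  assumes "0 < l" "l < t"
  obtains k :: nat where "l * 2 ^ k < t" "t \<le> l * 2 ^ Suc k"
proof -
  obtain n where n: "t / l < 2 ^ n" using real_arch_pow[of 2 "t / l"] by auto
  \<comment> \<open>The least such exponent is positive because \<open>l < t\<close>, and its
    predecessor is the required \<open>k\<close>.\<close>
  define m where "m = (LEAST n. t \<le> l * 2 ^ n)"
  have ex: "t \<le> l * 2 ^ n" using n assms by (simp add: field_simps)
  have m: "t \<le> l * 2 ^ m" unfolding m_def by (rule LeastI[of _ n]) (rule ex)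
  have "m \<noteq> 0"
  proof
    assume "m = 0" with m assms show False by simp
  qed
  then obtain k where k: "m = Suc k" using not0_implies_Suc by auto
  have "\<not> t \<le> l * 2 ^ k"
    using not_less_Least[of k "\<lambda>n. t \<le> l * 2 ^ n"] k by (simp add: m_def)
  then show ?thesis using m k that by force
qed

text \<open>Dyadic layer-cake argument: where \<open>\<bar>u\<bar>\<close> lies between
  \<open>l * 2 ^ k\<close> and \<open>l * 2 ^ Suc k\<close>, the power is at most the value at the
  upper end. The layers sum to a geometric series of ratio
  \<open>2 powr (\<rho> - \<sigma>)\<close>, which converges because \<rho> < \<sigma>.\<close>

lemma nn_integral_powr_le_of_level_sets:
  fixes u :: "'a::euclidean_space \<Rightarrow> real"
  assumes u: "u \<in> borel_measurable lebesgue" and Q: "Q \<in> lmeasurable"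
    and decay: "\<And>k. measure lebesgue {x \<in> Q. l * 2 ^ k < \<bar>u x\<bar>} \<le> D * 2 powr (- \<sigma> * real k)"
    and l: "0 < l" and "0 \<le> D" and \<rho>: "0 \<le> \<rho>" "\<rho> < \<sigma>"
  shows "(\<integral>\<^sup>+x. ennreal (\<bar>u x\<bar> powr \<rho>) * indicator Q x \<partial>lebesgue) \<le>
    ennreal (l powr \<rho> * measure lebesgue Q + (2 * l) powr \<rho> * D / (1 - 2 powr (\<rho> - \<sigma>)))"
proof -
  define E where "E k = {x \<in> Q. l * 2 ^ k < \<bar>u x\<bar>}" for k :: nat
  define w where "w k = (l * 2 ^ Suc k) powr \<rho>" for k :: nat
  define t where "t = 2 powr (\<rho> - \<sigma>)"
  have t: "0 < t" "t < 1" using \<rho> by (auto simp: t_def powr_less_one)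
  have E: "E k \<in> lmeasurable" for k
    unfolding E_def by (rule level_set_lmeasurable[OF u Q])
  \<comment> \<open>Whole level sets replace dyadic shells; the overlap only increases the
    right-hand side.\<close>
  have pw: "ennreal (\<bar>u x\<bar> powr \<rho>) * indicator Q x \<le>
      ennreal (l powr \<rho>) * indicator Q x + (\<Sum>k. ennreal (w k) * indicator (E k) x)" for x
  proof (cases "x \<in> Q \<and> l < \<bar>u x\<bar>")
    case True
    then obtain k where k: "l * 2 ^ k < \<bar>u x\<bar>" "\<bar>u x\<bar> \<le> l * 2 ^ Suc k"
      using dyadic_exponent_exists[OF l, of "\<bar>u x\<bar>"] by blast
    have "ennreal (\<bar>u x\<bar> powr \<rho>) \<le> ennreal (w k) * indicator (E k) x"
      using k True \<rho> by (auto simp: E_def w_def intro!: ennreal_leI powr_mono2)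
    also have "\<dots> \<le> (\<Sum>k. ennreal (w k) * indicator (E k) x)"
      using sum_le_suminf[of "\<lambda>k. ennreal (w k) * indicator (E k) x" "{k}"]
      by (simp only: sum.insert_if sum.empty finite.intros) simp
    finally show ?thesis using True by (simp add: add_increasing)
  next
    case False
    then have "ennreal (\<bar>u x\<bar> powr \<rho>) * indicator Q x \<le> ennreal (l powr \<rho>) * indicator Q x"
      using \<rho> by (auto split: split_indicator intro!: ennreal_leI powr_mono2)
    then show ?thesis by (rule order_trans) simp
  qed
  have "(\<integral>\<^sup>+x. ennreal (\<bar>u x\<bar> powr \<rho>) * indicator Q x \<partial>lebesgue) \<le>
      (\<integral>\<^sup>+x. ennreal (l powr \<rho>) * indicator Q x + (\<Sum>k. ennreal (w k) * indicator (E k) x) \<partial>lebesgue)"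
    by (intro nn_integral_mono pw)
  also have "\<dots> = ennreal (l powr \<rho>) * emeasure lebesgue Q + (\<Sum>k. ennreal (w k) * emeasure lebesgue (E k))"
    using Q E by (subst nn_integral_add)
      (auto simp: nn_integral_suminf nn_integral_cmult_indicator fmeasurableD)
  also have "\<dots> \<le> ennreal (l powr \<rho> * measure lebesgue Q) + (\<Sum>k. ennreal ((2 * l) powr \<rho> * D * t ^ k))"
  proof (intro add_mono suminf_le allI)
    show "ennreal (l powr \<rho>) * emeasure lebesgue Q \<le> ennreal (l powr \<rho> * measure lebesgue Q)"
      using Q by (simp add: emeasure_eq_measure2 ennreal_mult')
    fix k
    have wk: "w k = (2 * l) powr \<rho> * 2 powr (\<rho> * real k)"
    proof -
      have "w k = ((2 * l) * 2 powr real k) powr \<rho>"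
        by (simp add: w_def powr_realpow algebra_simps)
      then show ?thesis using l by (simp only: powr_mult powr_powr) (simp add: mult.commute)
    qed
    have "w k * measure lebesgue (E k) \<le> w k * (D * 2 powr (- \<sigma> * real k))"
      using decay[of k] by (intro mult_left_mono) (auto simp: E_def w_def)
    also have "\<dots> = (2 * l) powr \<rho> * D * t ^ k"
    proof -
      have "t ^ k = 2 powr (\<rho> * real k) * 2 powr (- \<sigma> * real k)"
        using t by (simp add: powr_realpow[symmetric] t_def powr_powr powr_add[symmetric] algebra_simps)
      then show ?thesis by (simp add: wk)
    qed
    finally have "w k * measure lebesgue (E k) \<le> (2 * l) powr \<rho> * D * t ^ k" .
    moreover have "0 \<le> w k" by (simp add: w_def)
    ultimately show "ennreal (w k) * emeasure lebesgue (E k) \<le> ennreal ((2 * l) powr \<rho> * D * t ^ k)"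
      using E[of k] by (simp add: emeasure_eq_measure2 ennreal_mult'[symmetric] ennreal_leI)
  qed auto
  also have "(\<Sum>k. ennreal ((2 * l) powr \<rho> * D * t ^ k)) = ennreal ((2 * l) powr \<rho> * D / (1 - t))"
    using t \<open>0 \<le> D\<close> by (subst suminf_ennreal2)
      (auto intro!: summable_mult summable_geometric simp: suminf_mult suminf_geometric divide_inverse)
  also have "ennreal (l powr \<rho> * measure lebesgue Q) + ennreal ((2 * l) powr \<rho> * D / (1 - t)) =
      ennreal (l powr \<rho> * measure lebesgue Q + (2 * l) powr \<rho> * D / (1 - t))"
    using t \<open>0 \<le> D\<close> by (subst ennreal_plus) auto
  finally show ?thesis by (simp add: t_def)
qed

text \<open>The weak bound starts the iteration: above a high enough level,
  \<open>\<bar>u\<bar>\<close> is large on at most half of the cube, and from there the decay of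
  level sets can be iterated. The constant is fixed before \<open>u\<close>, so it is uniform over
  all functions obeying the two bounds with the same \<open>M\<close>.\<close>

lemma cube_embedding:
  fixes p :: "'a::euclidean_space \<Rightarrow> 'a \<Rightarrow> real" and a :: 'a and L :: real
  defines "Q \<equiv> cbox a (a + L *\<^sub>R One)"
  assumes p: "continuous_on UNIV (\<lambda>(x, y). p x y)"
    and L: "0 < L" "real DIM('a) * L \<le> 1"
    and q: "\<And>x y. x \<in> Q \<Longrightarrow> y \<in> Q \<Longrightarrow> q \<le> p x y" "0 < q" and s: "0 < s"
    and sq: "s * q < real DIM('a)"
    and \<rho>: "0 \<le> \<rho>" "\<rho> * (real DIM('a) - s * q) < real DIM('a) * q" and M: "0 \<le> M"
  shows "\<exists>C\<ge>0. \<forall>u\<in>borel_measurable lebesgue. gagliardo_modular s p u \<le> ennreal M \<longrightarrow>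
    (\<forall>l\<ge>1. emeasure lebesgue {x. l < \<bar>u x\<bar>} \<le> ennreal (M / l)) \<longrightarrow>
    (\<integral>\<^sup>+x. ennreal (\<bar>u x\<bar> powr \<rho>) * indicator Q x \<partial>lebesgue) \<le> ennreal C"
proof -
  define N where "N = real DIM('a)"
  define V where "V = L ^ DIM('a)"
  define \<theta> where "\<theta> = s * q / N"
  define \<sigma> where "\<sigma> = q / (1 - \<theta>)"
  \<comment> \<open>Chosen so that \<open>M / l \<le> V / 2\<close>, which gives the smallness
    condition of the decay estimate at every level \<open>l * 2 ^ k\<close>.\<close>
  define l where "l = max 1 (2 * M / V)"
  define K where "K = N powr (N + s * q) * 2 powr (1 + s * q / N) * M"
  \<comment> \<open>The first entry dominates the initial measure, the second gives the condition on
    \<open>D\<close> demanded by the iteration.\<close>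
  define D where "D = max V ((K * 2 powr \<sigma>) powr (1 / (1 - \<theta>)))"
  define C where "C = l powr \<rho> * measure lebesgue Q + (2 * l) powr \<rho> * D / (1 - 2 powr (\<rho> - \<sigma>))"
  have N: "N > 0" by (simp add: N_def)
  have V: "V > 0" using L by (simp add: V_def)
  have \<theta>: "0 \<le> \<theta>" "\<theta> < 1" using s q(2) sq N by (auto simp: \<theta>_def N_def)
  have l: "l \<ge> 1" "M / l \<le> V / 2" using V M by (auto simp: l_def field_simps max_def)
  have K: "K \<ge> 0" using M by (simp add: K_def)
  have D: "D > 0" "V \<le> D" using V by (auto simp: D_def)
  have "K * 2 powr \<sigma> = ((K * 2 powr \<sigma>) powr (1 / (1 - \<theta>))) powr (1 - \<theta>)"
    using \<theta> K by (simp add: powr_powr)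
  also have "\<dots> \<le> D powr (1 - \<theta>)" using \<theta> by (intro powr_mono2) (auto simp: D_def)
  finally have KD: "K * 2 powr \<sigma> \<le> D powr (1 - \<theta>)" .
  \<comment> \<open>The decay rate \<sigma> equals \<open>N * q / (N - s * q)\<close>, the critical
    exponent of the constant \<open>q\<close>.\<close>
  have \<rho>\<sigma>: "\<rho> < \<sigma>"
  proof -
    have "1 - \<theta> = (N - s * q) / N" using N by (simp add: \<theta>_def field_simps)
    then have "\<sigma> = N * q / (N - s * q)" by (simp add: \<sigma>_def)
    then show ?thesis using \<rho>(2) sq by (simp add: N_def pos_less_divide_eq)
  qed
  have "(\<integral>\<^sup>+x. ennreal (\<bar>u x\<bar> powr \<rho>) * indicator Q x \<partial>lebesgue) \<le> ennreal C"
    if u: "u \<in> borel_measurable lebesgue" and Mu: "gagliardo_modular s p u \<le> ennreal M"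
      and weak: "\<forall>l\<ge>1. emeasure lebesgue {x. l < \<bar>u x\<bar>} \<le> ennreal (M / l)" for u
  proof -
    define a' where "a' k = measure lebesgue {x \<in> Q. l * 2 ^ k < \<bar>u x\<bar>}" for k :: nat
    have l2: "l \<le> l * 2 ^ k" for k :: nat using l by simp
    have small: "2 * a' k \<le> V" for k
    proof -
      have "{x \<in> space lebesgue. l * 2 ^ k < \<bar>u x\<bar>} \<in> sets lebesgue" using u by measurable
      then have "emeasure lebesgue {x \<in> Q. l * 2 ^ k < \<bar>u x\<bar>} \<le> emeasure lebesgue {x. l * 2 ^ k < \<bar>u x\<bar>}"
        by (intro emeasure_mono) auto
      also have "\<dots> \<le> ennreal (M / (l * 2 ^ k))" using weak order_trans[OF l(1) l2[of k]] by blast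
      also have "\<dots> \<le> ennreal (V / 2)"
        using l M l2[of k] by (intro ennreal_leI) (meson divide_left_mono less_le_trans mult_pos_pos order_trans zero_less_one)
      finally have "a' k \<le> V / 2"
        unfolding a'_def measure_def using V by (intro enn2real_leI) auto
      then show ?thesis by simp
    qed
    have "a' k \<le> D * 2 powr (- \<sigma> * real k)" for k
      unfolding \<sigma>_def
    proof (rule geometric_decay_of_recursion[OF _ _ D(1) K \<theta>])
      show "0 \<le> a' k" for k by (simp add: a'_def)
      show "a' 0 \<le> D" using small[of 0] D V by linarith
      show "K * 2 powr (q / (1 - \<theta>)) \<le> D powr (1 - \<theta>)" using KD by (simp add: \<sigma>_def)
      fix k
      have l1: "1 \<le> l * 2 ^ k" using l l2[of k] by linarith
      have "a' (Suc k) \<le> K * (l * 2 ^ k) powr (- q) * a' k powr \<theta>"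
        using level_set_decay[OF p u L q(1)[unfolded Q_def] q(2) s Mu M l1] small[of k]
        by (simp add: a'_def Q_def V_def K_def N_def \<theta>_def mult.left_commute)
      also have "(l * 2 ^ k) powr (- q) \<le> (2 ^ k) powr (- q)"
        using l q(2) by (intro powr_mono2') auto
      also have "(2 ^ k :: real) powr (- q) = 2 powr (- q * real k)"
        by (simp add: powr_realpow[symmetric] powr_powr mult.commute)
      finally show "a' (Suc k) \<le> K * 2 powr (- q * real k) * a' k powr \<theta>"
        using K by (simp add: mult_left_mono mult_right_mono)
    qed
    then show ?thesis
      unfolding C_def using l \<rho> \<rho>\<sigma> D u
      by (intro nn_integral_powr_le_of_level_sets) (auto simp: a'_def Q_def)
  qed
  moreover have "C \<ge> 0"
  proof -
    have "2 powr (\<rho> - \<sigma>) < 1" using \<rho>\<sigma> by (intro powr_less_one) auto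
    then show ?thesis using D unfolding C_def by (intro add_nonneg_nonneg) auto
  qed
  ultimately show ?thesis by (intro exI[of _ C]) auto
qed

section \<open>Embedding on compact sets\<close>

lemma sym_exponents_bounds:
  assumes "p \<in> sym_exponents"
  shows "exp_inf p \<le> p x y" "p x y \<le> exp_sup p" "1 < exp_inf p"
    "continuous_on UNIV (\<lambda>(x, y). p x y)"
proof -
  have "bdd_below (range (\<lambda>(x, y). p x y))" "bdd_above (range (\<lambda>(x, y). p x y))"
    using assms by (auto simp: sym_exponents_def)
  then show "exp_inf p \<le> p x y" "p x y \<le> exp_sup p"
    unfolding exp_inf_def exp_sup_def
    using cINF_lower[of "\<lambda>(x, y). p x y" UNIV "(x, y)"] cSUP_upper[of "(x, y)" UNIV "\<lambda>(x, y). p x y"]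
    by auto
  show "1 < exp_inf p" "continuous_on UNIV (\<lambda>(x, y). p x y)"
    using assms by (auto simp: sym_exponents_def)
qed

text \<open>Strict subcriticality is an open condition, so it survives lowering \<open>P\<close> and
  raising \<open>r\<close> by the same small amount.\<close>

lemma subcritical_perturbation:
  fixes N P r s :: real
  assumes "0 < P" "r * (N - s * P) < N * P"
  shows "\<exists>\<epsilon>>0. \<epsilon> < P \<and> (r + \<epsilon>) * (N - s * (P - \<epsilon>)) < N * (P - \<epsilon>)"
proof -
  have "((\<lambda>\<epsilon>. N * (P - \<epsilon>) - (r + \<epsilon>) * (N - s * (P - \<epsilon>))) \<longlongrightarrow> N * (P - 0) - (r + 0) * (N - s * (P - 0)))
      (at_right 0)"
    by (intro tendsto_intros)
  then have "\<forall>\<^sub>F \<epsilon> in at_right 0. 0 < N * (P - \<epsilon>) - (r + \<epsilon>) * (N - s * (P - \<epsilon>))"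
    using assms(2) by (intro order_tendstoD(1)) auto
  moreover have "\<forall>\<^sub>F \<epsilon> in at_right 0. 0 < \<epsilon> \<and> \<epsilon> < P"
    using assms(1) by (auto simp: eventually_at_right intro!: exI[of _ P])
  ultimately have "\<forall>\<^sub>F \<epsilon> in at_right 0. \<epsilon> > 0 \<and> \<epsilon> < P \<and>
      (r + \<epsilon>) * (N - s * (P - \<epsilon>)) < N * (P - \<epsilon>)"
    by eventually_elim auto
  then show ?thesis
    using eventually_happens'[of "at_right (0 :: real)"] by fastforce
qed

lemma powr_le_one_plus_powr:
  fixes t a b :: real
  assumes "0 \<le> t" "0 \<le> a" "a \<le> b"
  shows "t powr a \<le> 1 + t powr b"
proof (cases "t \<le> 1")
  case True
  then have "t powr a \<le> 1" using assms powr_le1 by simp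
  then show ?thesis using powr_ge_zero[of t b] by linarith
next
  case False
  then have "t powr a \<le> t powr b" using assms by (intro powr_mono) auto
  then show ?thesis by simp
qed

text \<open>Near \<open>x0\<close> the variable exponents are compared with constants: on a small
  cube \<open>p\<close> is at least \<open>P - \<epsilon>\<close> and \<open>r\<close> at most
  \<open>r x0 + \<epsilon>\<close>, and this pair is still subcritical.\<close>

lemma local_embedding:
  fixes p :: "'a::euclidean_space \<Rightarrow> 'a \<Rightarrow> real" and r :: "'a \<Rightarrow> real"
  assumes p: "p \<in> sym_exponents" and s: "0 < s" "s * exp_sup p < real DIM('a)"
    and r: "continuous_on S r" "\<And>x. x \<in> S \<Longrightarrow> 0 \<le> r x" "\<And>x. x \<in> S \<Longrightarrow> r x < crit_exp s p x"
    and M: "0 \<le> M" and x0: "x0 \<in> S"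
  shows "\<exists>W C. open W \<and> x0 \<in> W \<and> 0 \<le> C \<and> (\<forall>u\<in>borel_measurable lebesgue.
    gagliardo_modular s p u \<le> ennreal M \<longrightarrow>
    (\<forall>l\<ge>1. emeasure lebesgue {x. l < \<bar>u x\<bar>} \<le> ennreal (M / l)) \<longrightarrow>
    (\<integral>\<^sup>+x. ennreal (\<bar>u x\<bar> powr r x) * indicator (S \<inter> W) x \<partial>lebesgue) \<le> ennreal C)"
proof -
  define N where "N = real DIM('a)"
  have N: "N > 0" by (simp add: N_def)
  note pb = sym_exponents_bounds[OF p]
  define P where "P = p x0 x0"
  have P: "0 < P" using pb(1)[of x0 x0] pb(3) by (simp add: P_def)
  have "s * P \<le> s * exp_sup p" using s pb(2) by (simp add: P_def)
  then have sP: "s * P < N" using s(2) unfolding N_def by linarith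
  have "r x0 < N * P / (N - s * P)"
    using r(3)[OF x0] by (simp add: crit_exp_def diag_exp_def P_def N_def)
  then have "r x0 * (N - s * P) < N * P" using sP by (simp add: pos_less_divide_eq)
  then obtain \<epsilon> where \<epsilon>: "0 < \<epsilon>" "\<epsilon> < P" "(r x0 + \<epsilon>) * (N - s * (P - \<epsilon>)) < N * (P - \<epsilon>)"
    using subcritical_perturbation P by blast
  have "isCont (\<lambda>(x, y). p x y) (x0, x0)"
    using pb(4) by (simp add: continuous_on_eq_continuous_at)
  then obtain \<delta>1 where \<delta>1: "\<delta>1 > 0"
      "\<And>z. dist z (x0, x0) < \<delta>1 \<Longrightarrow> dist ((\<lambda>(x, y). p x y) z) (p x0 x0) < \<epsilon>"
    using \<epsilon>(1) unfolding continuous_at_eps_delta by (auto simp: split_beta dist_commute)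
  obtain \<delta>2 where \<delta>2: "\<delta>2 > 0" "\<And>x. x \<in> S \<Longrightarrow> dist x x0 < \<delta>2 \<Longrightarrow> dist (r x) (r x0) < \<epsilon>"
    using r(1) x0 \<epsilon>(1) unfolding continuous_on_iff by blast
  \<comment> \<open>The bound 1 is what the cube estimate asks for. The bound
    \<open>\<delta>1 / 3\<close> leaves room for the two coordinates of a pair to move at once, and
    \<open>\<delta>2 / 2\<close> controls the oscillation of \<open>r\<close>.\<close>
  define L where "L = min 1 (min (\<delta>1 / 3) (\<delta>2 / 2)) / N"
  have L: "0 < L" "N * L \<le> 1" "N * L < \<delta>1 / 2" "N * L < \<delta>2"
    using N \<delta>1(1) \<delta>2(1) by (auto simp: L_def)
  define a where "a = x0 - (L / 2) *\<^sub>R One"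
  define Q where "Q = cbox a (a + L *\<^sub>R One)"
  define W where "W = box a (a + L *\<^sub>R One)"
  have x0W: "x0 \<in> W" using L by (auto simp: W_def a_def mem_box inner_diff_left inner_add_left)
  have WQ: "W \<subseteq> Q" by (simp add: W_def Q_def box_subset_cbox)
  have close: "dist x x0 \<le> N * L" if "x \<in> Q" for x
    using norm_diff_le_cube[of x a L x0] that x0W WQ by (auto simp: Q_def N_def dist_norm)
  have pQ: "P - \<epsilon> \<le> p x y" if "x \<in> Q" "y \<in> Q" for x y
  proof -
    have "dist (x, y) (x0, x0) \<le> dist x x0 + dist y x0"
      by (simp add: dist_Pair_Pair sqrt_sum_squares_le_sum)
    also have "\<dots> < \<delta>1" using close[OF that(1)] close[OF that(2)] L by linarith
    finally show ?thesis using \<delta>1(2)[of "(x, y)"] by (auto simp: P_def dist_real_def)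
  qed
  have "s * (P - \<epsilon>) < N" using sP s(1) \<epsilon>(1) by (simp add: right_diff_distrib) (smt (verit) mult_pos_pos)
  then obtain C where C: "0 \<le> C" "\<And>u. u \<in> borel_measurable lebesgue \<Longrightarrow>
      gagliardo_modular s p u \<le> ennreal M \<Longrightarrow>
      \<forall>l\<ge>1. emeasure lebesgue {x. l < \<bar>u x\<bar>} \<le> ennreal (M / l) \<Longrightarrow>
      (\<integral>\<^sup>+x. ennreal (\<bar>u x\<bar> powr (r x0 + \<epsilon>)) * indicator Q x \<partial>lebesgue) \<le> ennreal C"
    using cube_embedding[OF pb(4) L(1) _ pQ[unfolded Q_def], where a = a and s = s and \<rho> = "r x0 + \<epsilon>" and M = M] L(2) \<epsilon> s(1) M r(2)[OF x0]
    unfolding Q_def N_def by auto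
  have "(\<integral>\<^sup>+x. ennreal (\<bar>u x\<bar> powr r x) * indicator (S \<inter> W) x \<partial>lebesgue) \<le> ennreal (measure lebesgue Q + C)"
    if u: "u \<in> borel_measurable lebesgue" and "gagliardo_modular s p u \<le> ennreal M"
      "\<forall>l\<ge>1. emeasure lebesgue {x. l < \<bar>u x\<bar>} \<le> ennreal (M / l)" for u
  proof -
    \<comment> \<open>The extra indicator pays for points with
      \<open>\<bar>u x\<bar> \<le> 1\<close>, where raising the exponent can decrease the
      power.\<close>
    have pw: "ennreal (\<bar>u x\<bar> powr r x) * indicator (S \<inter> W) x \<le>
        indicator Q x + ennreal (\<bar>u x\<bar> powr (r x0 + \<epsilon>)) * indicator Q x" for x
    proof (cases "x \<in> S \<inter> W")
      case True
      then have xQ: "x \<in> Q" using WQ by auto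
      have "dist x x0 < \<delta>2" using close[OF xQ] L by linarith
      then have "r x \<le> r x0 + \<epsilon>" using \<delta>2(2)[of x] True by (auto simp: dist_real_def)
      then have "\<bar>u x\<bar> powr r x \<le> 1 + \<bar>u x\<bar> powr (r x0 + \<epsilon>)"
        using r(2)[of x] True by (intro powr_le_one_plus_powr) auto
      then have "ennreal (\<bar>u x\<bar> powr r x) \<le> ennreal (1 + \<bar>u x\<bar> powr (r x0 + \<epsilon>))" by (rule ennreal_leI)
      then show ?thesis using True xQ by simp
    qed auto
    have Qs: "Q \<in> sets lebesgue" by (simp add: Q_def)
    have "(\<integral>\<^sup>+x. ennreal (\<bar>u x\<bar> powr r x) * indicator (S \<inter> W) x \<partial>lebesgue) \<le>
        (\<integral>\<^sup>+x. indicator Q x + ennreal (\<bar>u x\<bar> powr (r x0 + \<epsilon>)) * indicator Q x \<partial>lebesgue)"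
      by (intro nn_integral_mono pw)
    also have "\<dots> = emeasure lebesgue Q + (\<integral>\<^sup>+x. ennreal (\<bar>u x\<bar> powr (r x0 + \<epsilon>)) * indicator Q x \<partial>lebesgue)"
      using u Qs by (subst nn_integral_add) auto
    also have "\<dots> \<le> ennreal (measure lebesgue Q) + ennreal C"
      using C(2)[OF that] by (intro add_mono) (auto simp: Q_def emeasure_eq_measure2)
    finally show ?thesis using C(1) by simp
  qed
  then show ?thesis
    using x0W C(1) by (intro exI[of _ W] exI[of _ "measure lebesgue Q + C"]) (auto simp: W_def)
qed

text \<open>A finite subcover by the local neighbourhoods; the local constants are added.
  Neighbourhoods and constants are chosen before \<open>u\<close>, so the bound is uniform.\<close>

lemma compact_embedding_bound:
  fixes p :: "'a::euclidean_space \<Rightarrow> 'a \<Rightarrow> real" and r :: "'a \<Rightarrow> real"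
  assumes p: "p \<in> sym_exponents" and s: "0 < s" "s * exp_sup p < real DIM('a)" and S: "compact S"
    and r: "continuous_on S r" "\<And>x. x \<in> S \<Longrightarrow> 0 \<le> r x" "\<And>x. x \<in> S \<Longrightarrow> r x < crit_exp s p x"
    and M: "0 \<le> M"
  shows "\<exists>C\<ge>0. \<forall>u\<in>borel_measurable lebesgue. gagliardo_modular s p u \<le> ennreal M \<longrightarrow>
    (\<forall>l\<ge>1. emeasure lebesgue {x. l < \<bar>u x\<bar>} \<le> ennreal (M / l)) \<longrightarrow>
    (\<integral>\<^sup>+x. ennreal (\<bar>u x\<bar> powr r x) * indicator S x \<partial>lebesgue) \<le> ennreal C"
proof -
  define good where "good W C \<longleftrightarrow> 0 \<le> C \<and> (\<forall>u\<in>borel_measurable lebesgue.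
    gagliardo_modular s p u \<le> ennreal M \<longrightarrow>
    (\<forall>l\<ge>1. emeasure lebesgue {x. l < \<bar>u x\<bar>} \<le> ennreal (M / l)) \<longrightarrow>
    (\<integral>\<^sup>+x. ennreal (\<bar>u x\<bar> powr r x) * indicator (S \<inter> W) x \<partial>lebesgue) \<le> ennreal C)" for W C
  have "\<forall>x\<in>S. \<exists>W C. open W \<and> x \<in> W \<and> good W C"
    unfolding good_def using local_embedding[OF p s r M] by blast
  then obtain W C where W: "\<And>x. x \<in> S \<Longrightarrow> open (W x)" "\<And>x. x \<in> S \<Longrightarrow> x \<in> W x"
      and good: "\<And>x. x \<in> S \<Longrightarrow> good (W x) (C x)"
    by metis
  have C: "0 \<le> C x"
      "u \<in> borel_measurable lebesgue \<Longrightarrow> gagliardo_modular s p u \<le> ennreal M \<Longrightarrow>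
        \<forall>l\<ge>1. emeasure lebesgue {x. l < \<bar>u x\<bar>} \<le> ennreal (M / l) \<Longrightarrow>
        (\<integral>\<^sup>+y. ennreal (\<bar>u y\<bar> powr r y) * indicator (S \<inter> W x) y \<partial>lebesgue) \<le> ennreal (C x)"
    if "x \<in> S" for x u
    using good[OF that] unfolding good_def by blast+
  obtain F where F: "F \<subseteq> S" "finite F" "S \<subseteq> (\<Union>x\<in>F. W x)"
    using compactE_image[OF S, of S W] W by blast
  have "(\<integral>\<^sup>+y. ennreal (\<bar>u y\<bar> powr r y) * indicator S y \<partial>lebesgue) \<le> ennreal (\<Sum>x\<in>F. C x)"
    if u: "u \<in> borel_measurable lebesgue" and "gagliardo_modular s p u \<le> ennreal M"
      "\<forall>l\<ge>1. emeasure lebesgue {x. l < \<bar>u x\<bar>} \<le> ennreal (M / l)" for u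
  proof -
    have Sb: "S \<in> sets borel" using S by (simp add: compact_imp_closed)
    \<comment> \<open>Continuity of \<open>r\<close> is known on \<open>S\<close> only; extension by
      0 gives a measurable exponent that agrees with \<open>r\<close> wherever the integrands do not
      vanish.\<close>
    define r' where "r' = (\<lambda>y. indicator S y *\<^sub>R r y)"
    have r': "r' \<in> borel_measurable lebesgue"
      unfolding r'_def
      using borel_measurable_continuous_on_indicator[OF Sb r(1)] by (simp add: measurable_completion)
    have meas: "(\<lambda>y. ennreal (\<bar>u y\<bar> powr r y) * indicator (S \<inter> W x) y) \<in> borel_measurable lebesgue"
      if "x \<in> F" for x
    proof -
      have "S \<inter> W x \<in> sets lebesgue" using that F W(1)[of x] Sb by auto
      then have "(\<lambda>y. ennreal (\<bar>u y\<bar> powr r' y) * indicator (S \<inter> W x) y) \<in> borel_measurable lebesgue"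
        using u r' by measurable
      moreover have "(\<lambda>y. ennreal (\<bar>u y\<bar> powr r' y) * indicator (S \<inter> W x) y) =
          (\<lambda>y. ennreal (\<bar>u y\<bar> powr r y) * indicator (S \<inter> W x) y)"
        by (auto simp: r'_def split: split_indicator)
      ultimately show ?thesis by simp
    qed
    have pw: "ennreal (\<bar>u y\<bar> powr r y) * indicator S y \<le>
        (\<Sum>x\<in>F. ennreal (\<bar>u y\<bar> powr r y) * indicator (S \<inter> W x) y)" for y
    proof (cases "y \<in> S")
      case True
      then obtain x where x: "x \<in> F" "y \<in> W x" using F by auto
      then have "ennreal (\<bar>u y\<bar> powr r y) * indicator S y = ennreal (\<bar>u y\<bar> powr r y) * indicator (S \<inter> W x) y"
        using True by simp
      also have "\<dots> \<le> (\<Sum>x\<in>F. ennreal (\<bar>u y\<bar> powr r y) * indicator (S \<inter> W x) y)"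
        by (intro member_le_sum x F) auto
      finally show ?thesis .
    qed simp
    have "(\<integral>\<^sup>+y. ennreal (\<bar>u y\<bar> powr r y) * indicator S y \<partial>lebesgue) \<le>
        (\<integral>\<^sup>+y. (\<Sum>x\<in>F. ennreal (\<bar>u y\<bar> powr r y) * indicator (S \<inter> W x) y) \<partial>lebesgue)"
      by (intro nn_integral_mono pw)
    also have "\<dots> = (\<Sum>x\<in>F. \<integral>\<^sup>+y. ennreal (\<bar>u y\<bar> powr r y) * indicator (S \<inter> W x) y \<partial>lebesgue)"
      by (intro nn_integral_sum meas)
    also have "\<dots> \<le> (\<Sum>x\<in>F. ennreal (C x))"
      using F(1) C(2)[OF _ that] by (intro sum_mono) auto
    also have "\<dots> = ennreal (\<Sum>x\<in>F. C x)"
      using F C(1) by (intro sum_ennreal) auto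
    finally show ?thesis .
  qed
  then show ?thesis
    using C(1) F(1) by (intro exI[of _ "\<Sum>x\<in>F. C x"]) (auto intro!: sum_nonneg)
qed

text \<open>Chebyshev's inequality: where \<open>\<bar>u x\<bar> > l \<ge> 1\<close>, an exponent at
  least 1 gives a power of at least \<open>l\<close>.\<close>

lemma Lvar_level_set_bound:
  assumes u: "u \<in> Lvar q UNIV" and q: "\<And>x. 1 \<le> q x"
  shows "\<exists>M\<ge>0. \<forall>l\<ge>1. emeasure lebesgue {x. l < \<bar>u x\<bar>} \<le> ennreal (M / l)"
proof -
  have um: "u \<in> borel_measurable lebesgue"
    and fin: "(\<integral>\<^sup>+x. ennreal (\<bar>u x\<bar> powr q x) \<partial>lebesgue) < \<infinity>"
    using u by (auto simp: Lvar_def lebesgue_on_UNIV_eq)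
  define M where "M = enn2real (\<integral>\<^sup>+x. ennreal (\<bar>u x\<bar> powr q x) \<partial>lebesgue)"
  have "emeasure lebesgue {x. l < \<bar>u x\<bar>} \<le> ennreal (M / l)" if l: "1 \<le> l" for l
  proof -
    have "{x \<in> space lebesgue. l < \<bar>u x\<bar>} \<in> sets lebesgue" using um by measurable
    then have "ennreal l * emeasure lebesgue {x. l < \<bar>u x\<bar>} =
        (\<integral>\<^sup>+x. ennreal l * indicator {x. l < \<bar>u x\<bar>} x \<partial>lebesgue)"
      by (simp add: nn_integral_cmult_indicator)
    also have "\<dots> \<le> (\<integral>\<^sup>+x. ennreal (\<bar>u x\<bar> powr q x) \<partial>lebesgue)"
    proof (intro nn_integral_mono)
      fix x
      have "l \<le> \<bar>u x\<bar> powr q x" if "l < \<bar>u x\<bar>"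
      proof -
        have "l \<le> \<bar>u x\<bar> powr 1" using that l by simp
        also have "\<dots> \<le> \<bar>u x\<bar> powr q x" using that l q by (intro powr_mono) auto
        finally show ?thesis .
      qed
      then show "ennreal l * indicator {x. l < \<bar>u x\<bar>} x \<le> ennreal (\<bar>u x\<bar> powr q x)"
        by (auto split: split_indicator intro: ennreal_leI)
    qed
    also have "\<dots> = ennreal M" using fin by (simp add: M_def)
    finally have "ennreal l * emeasure lebesgue {x. l < \<bar>u x\<bar>} \<le> ennreal M" .
    then have "ennreal (1 / l) * (ennreal l * emeasure lebesgue {x. l < \<bar>u x\<bar>}) \<le> ennreal (1 / l) * ennreal M"
      by (intro mult_left_mono) auto
    moreover have "ennreal (1 / l) * ennreal l = 1"
      using l by (subst ennreal_mult'[symmetric]) auto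
    moreover have "ennreal (1 / l) * ennreal M = ennreal (M / l)"
      using l by (subst ennreal_mult'[symmetric]) auto
    ultimately show ?thesis by (simp add: mult.assoc[symmetric])
  qed
  then show ?thesis by (intro exI[of _ M]) (auto simp: M_def)
qed

text \<open>A Poincare-type estimate: the points where \<open>u\<close> is large interact with a fixed ball on which
  \<open>u\<close> vanishes.\<close>

lemma vanishing_outside_level_set_bound:
  fixes p :: "'a::euclidean_space \<Rightarrow> 'a \<Rightarrow> real"
  assumes \<Omega>: "bounded \<Omega>" "\<Omega> \<in> sets lebesgue" and p: "continuous_on UNIV (\<lambda>(x, y). p x y)"
    and pb: "\<And>x y. 1 \<le> p x y" "\<And>x y. p x y \<le> P" and s: "0 < s"
  shows "\<exists>C\<ge>0. \<forall>u\<in>borel_measurable lebesgue. (AE x in lebesgue. x \<notin> \<Omega> \<longrightarrow> u x = 0) \<longrightarrow>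
    gagliardo_modular s p u \<le> 1 \<longrightarrow> (\<forall>l\<ge>1. emeasure lebesgue {x. l < \<bar>u x\<bar>} \<le> ennreal (C / l))"
proof -
  define N where "N = real DIM('a)"
  obtain R where R: "R > 0" "\<And>x. x \<in> \<Omega> \<Longrightarrow> norm x \<le> R" using \<Omega>(1) bounded_pos by blast
  obtain e :: 'a where e: "e \<in> Basis" using nonempty_Basis by blast
  \<comment> \<open>The set \<Omega> lies in the closed ball of radius \<open>R\<close> about 0, so
    the open unit ball about a point of norm \<open>R + 1\<close> misses it.\<close>
  define z where "z = (R + 1) *\<^sub>R e"
  have z: "norm z = R + 1" using R e by (simp add: z_def)
  define D where "D = 2 * R + 2"
  define E where "E = ball z 1"
  define m where "m = measure lebesgue E"
  have m: "m > 0" by (simp add: m_def E_def content_ball_pos)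
  have E: "norm y > R" "norm y \<le> R + 2" if "y \<in> E" for y
    using that z norm_triangle_ineq2[of z y] norm_triangle_ineq2[of y z]
    by (auto simp: E_def dist_norm norm_minus_commute)
  \<comment> \<open>Lower bound for the kernel between \<Omega> and the ball: \<open>D\<close>
    exceeds 1 and bounds all distances involved, so the largest exponent \<open>P\<close> is the
    worst case.\<close>
  define b where "b = D powr (- (N + s * P))"
  have b: "b > 0" using R by (simp add: b_def D_def)
  have "emeasure lebesgue {x. l < \<bar>u x\<bar>} \<le> ennreal (1 / (b * m) / l)"
    if u: "u \<in> borel_measurable lebesgue" and ae: "AE x in lebesgue. x \<notin> \<Omega> \<longrightarrow> u x = 0"
      and Mu: "gagliardo_modular s p u \<le> 1" and l: "1 \<le> l" for u l
  proof -
    have lev: "{x. l < \<bar>u x\<bar>} \<in> sets lebesgue"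
    proof -
      have "{x \<in> space lebesgue. l < \<bar>u x\<bar>} \<in> sets lebesgue" using u by measurable
      then show ?thesis by simp
    qed
    define A where "A = {x. l < \<bar>u x\<bar>} \<inter> \<Omega>"
    have A: "A \<in> sets lebesgue" using lev \<Omega>(2) by (auto simp: A_def)
    have "ennreal (l * b) * ennreal m * emeasure lebesgue A \<le> gagliardo_modular s p u"
      unfolding gagliardo_modular_def
    proof (rule nn_integral_pair_lower_bound)
      show "(\<lambda>z. ennreal (gagliardo_integrand s p u z)) \<in> borel_measurable (lebesgue \<Otimes>\<^sub>M lebesgue)"
        using gagliardo_integrand_measurable[OF p u] by measurable
      show "A \<in> sets lebesgue" by (rule A)
      fix x assume x: "x \<in> A"
      have pw: "ennreal (l * b) \<le> ennreal (gagliardo_integrand s p u (x, y))"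
        if y: "y \<in> E" and 0: "y \<notin> \<Omega> \<longrightarrow> u y = 0" for y
      proof -
        have "y \<notin> \<Omega>" using E(1)[OF y] R(2)[of y] by auto
        then have uy: "u y = 0" using 0 by simp
        have ux: "l < \<bar>u x\<bar>" and xn: "norm x \<le> R" using x R(2) by (auto simp: A_def)
        have xy: "norm (x - y) > 0" using ux uy l by auto
        have dist: "norm (x - y) \<le> D"
          using norm_triangle_ineq4[of x y] xn E(2)[OF y] by (simp add: D_def)
        have sp: "s * p x y \<ge> 0" using s pb(1)[of x y] by simp
        have "b \<le> D powr (- (N + s * p x y))"
          unfolding b_def using R s pb(2) by (intro powr_mono) (auto simp: D_def)
        also have "\<dots> \<le> norm (x - y) powr (- (N + s * p x y))"
          using dist xy sp by (intro powr_mono2') (auto simp: N_def)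
        finally have 1: "b \<le> norm (x - y) powr (- (N + s * p x y))" .
        have "l powr 1 \<le> l powr p x y" using l pb(1) by (intro powr_mono) auto
        also have "\<dots> \<le> \<bar>u x\<bar> powr p x y"
          using ux l pb(1)[of x y] by (intro powr_mono2) auto
        finally have "l \<le> \<bar>u x - u y\<bar> powr p x y" using l uy by simp
        then have "l * b \<le> \<bar>u x - u y\<bar> powr p x y * norm (x - y) powr (- (N + s * p x y))"
          using 1 b by (intro mult_mono) auto
        also have "\<dots> = gagliardo_integrand s p u (x, y)"
          unfolding gagliardo_integrand_def prod.case N_def[symmetric]
          by (subst powr_minus) (simp add: divide_inverse)
        finally show ?thesis by (rule ennreal_leI)
      qed
      have "AE y in lebesgue. y \<in> E \<longrightarrow> ennreal (l * b) \<le> ennreal (gagliardo_integrand s p u (x, y))"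
        using ae by eventually_elim (use pw in blast)
      moreover have "ennreal m \<le> emeasure lebesgue E"
        by (simp add: m_def E_def emeasure_eq_measure2)
      ultimately show "\<exists>S\<in>sets lebesgue. ennreal m \<le> emeasure lebesgue S \<and>
          (AE y in lebesgue. y \<in> S \<longrightarrow> ennreal (l * b) \<le> ennreal (gagliardo_integrand s p u (x, y)))"
        by (intro bexI[of _ E]) (auto simp: E_def)
    qed
    also have "\<dots> \<le> 1" by (rule Mu)
    finally have *: "ennreal (l * b) * ennreal m * emeasure lebesgue A \<le> 1" .
    define k where "k = l * b * m"
    have k: "k > 0" using l b m by (simp add: k_def)
    have "ennreal k * emeasure lebesgue A \<le> 1"
      using * b l m by (simp add: k_def ennreal_mult')
    then have "ennreal (1 / k) * (ennreal k * emeasure lebesgue A) \<le> ennreal (1 / k) * 1"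
      by (intro mult_left_mono) auto
    moreover have "ennreal (1 / k) * ennreal k = 1"
      using k by (subst ennreal_mult'[symmetric]) auto
    ultimately have "emeasure lebesgue A \<le> ennreal (1 / k)"
      by (simp add: mult.assoc[symmetric])
    \<comment> \<open>Almost everywhere outside \<Omega> the function vanishes, and 0 is not above
      the level \<open>l\<close>.\<close>
    moreover have "emeasure lebesgue {x. l < \<bar>u x\<bar>} = emeasure lebesgue A"
      using ae l lev A by (intro emeasure_eq_AE) (auto simp: A_def elim!: eventually_mono)
    ultimately show ?thesis by (simp add: k_def mult_ac)
  qed
  moreover have "1 / (b * m) \<ge> 0" using b m by simp
  ultimately show ?thesis by blast
qed

section \<open>Energy estimate\<close>

lemma Wsp_iff: "u \<in> Wsp s p \<longleftrightarrow> u \<in> Lvar (diag_exp p) UNIV \<and> gagliardo_modular s p u < \<infinity>"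
  by (simp add: Wsp_def gagliardo_modular_def gagliardo_integrand_def case_prod_unfold)

lemma Wsp_measurable: "u \<in> Wsp s p \<Longrightarrow> u \<in> borel_measurable lebesgue"
  by (simp add: Wsp_def Lvar_def lebesgue_on_UNIV_eq)

lemma gagliardo_integrable:
  assumes "continuous_on UNIV (\<lambda>(x, y). p x y)" "u \<in> borel_measurable lebesgue"
    "gagliardo_modular s p u < \<infinity>"
  shows "integrable (lebesgue \<Otimes>\<^sub>M lebesgue) (gagliardo_integrand s p u)"
    "(\<integral>z. gagliardo_integrand s p u z \<partial>(lebesgue \<Otimes>\<^sub>M lebesgue)) = enn2real (gagliardo_modular s p u)"
proof -
  show "integrable (lebesgue \<Otimes>\<^sub>M lebesgue) (gagliardo_integrand s p u)"
    using assms(3) gagliardo_integrand_measurable[OF assms(1,2)]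
    by (intro integrableI_bounded) (auto simp: gagliardo_modular_def gagliardo_integrand_nonneg)
  show "(\<integral>z. gagliardo_integrand s p u z \<partial>(lebesgue \<Otimes>\<^sub>M lebesgue)) = enn2real (gagliardo_modular s p u)"
    unfolding gagliardo_modular_def using gagliardo_integrand_measurable[OF assms(1,2)]
    by (intro integral_eq_nn_integral) (auto simp: gagliardo_integrand_nonneg)
qed

lemma powr_abs_diff_le:
  fixes a b t :: real
  assumes "0 \<le> t"
  shows "\<bar>a - b\<bar> powr t \<le> 2 powr t * (\<bar>a\<bar> powr t + \<bar>b\<bar> powr t)"
proof -
  have "\<bar>a - b\<bar> powr t \<le> (2 * max \<bar>a\<bar> \<bar>b\<bar>) powr t" using assms by (intro powr_mono2) auto
  also have "\<dots> = 2 powr t * max \<bar>a\<bar> \<bar>b\<bar> powr t" by (simp add: powr_mult)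
  also have "\<dots> \<le> 2 powr t * (\<bar>a\<bar> powr t + \<bar>b\<bar> powr t)"
    by (intro mult_left_mono) (auto simp: max_def)
  finally show ?thesis .
qed

text \<open>A Young inequality with crude constants: the smaller of \<open>a\<close> and
  \<open>b\<close> is replaced by the larger. It dominates the integrand of the pairing.\<close>

lemma powr_times_le_add_powr:
  fixes a b t :: real
  assumes "0 \<le> a" "0 \<le> b" "1 \<le> t"
  shows "a powr (t - 1) * b \<le> a powr t + b powr t"
proof (cases "a \<le> b")
  case True
  have "a powr (t - 1) * b \<le> b powr (t - 1) * b"
    using True assms by (intro mult_right_mono powr_mono2) auto
  also have "\<dots> = b powr t" using assms by (cases "b = 0") (auto simp: powr_diff)
  finally show ?thesis by (simp add: add_increasing)
next
  case False
  then have "a powr (t - 1) * b \<le> a powr (t - 1) * a" by (intro mult_left_mono) auto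
  also have "\<dots> = a powr t" using False assms by (auto simp: powr_diff)
  finally show ?thesis by (simp add: add_increasing2)
qed

lemma abs_powr_minus_two_mult: "\<bar>a\<bar> powr (t - 2) * \<bar>a\<bar> = \<bar>a :: real\<bar> powr (t - 1)"
proof (cases "a = 0")
  case False
  then have "\<bar>a\<bar> powr (t - 2) * \<bar>a\<bar> = \<bar>a\<bar> powr (t - 2) * \<bar>a\<bar> powr 1" by simp
  also have "\<dots> = \<bar>a\<bar> powr (t - 1)" by (subst powr_add[symmetric]) simp
  finally show ?thesis .
qed simp

text \<open>Coercivity at a pair of points, with \<open>a\<close> and \<open>b\<close> the
  differences of \<open>u\<close> and of \<open>g\<close>, so that \<open>a - b\<close> is the
  difference of \<open>u - g\<close>. The constants depend only on the upper bound \<open>P\<close>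
  of the exponent, which permits integration with variable \<open>t\<close>.\<close>

lemma monotone_flux_lower_bound:
  fixes a b t P :: real
  assumes t: "1 < t" "t \<le> P"
  shows "2 powr (- P) / 2 * \<bar>a - b\<bar> powr t - (1 / 2 + 2 powr P) * \<bar>b\<bar> powr t
    \<le> \<bar>a\<bar> powr (t - 2) * a * (a - b)"
proof -
  have aa: "\<bar>a\<bar> powr (t - 1) * \<bar>a\<bar> = \<bar>a\<bar> powr t"
    using t by (cases "a = 0") (auto simp: powr_diff)
  have "\<bar>a\<bar> powr (t - 1) * \<bar>b\<bar> \<le> \<bar>a\<bar> powr t / 2 + 2 powr P * \<bar>b\<bar> powr t"
  \<comment> \<open>If \<open>b\<close> is small, half of \<open>\<bar>a\<bar> powr t\<close>
    absorbs the cross term; otherwise \<open>a\<close> is bounded by a multiple of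
    \<open>b\<close>.\<close>
  proof (cases "2 * \<bar>b\<bar> \<le> \<bar>a\<bar>")
    case True
    then have "\<bar>a\<bar> powr (t - 1) * \<bar>b\<bar> \<le> \<bar>a\<bar> powr (t - 1) * (\<bar>a\<bar> / 2)" by (intro mult_left_mono) auto
    then show ?thesis using aa by (simp add: add_increasing2)
  next
    case False
    then have "\<bar>a\<bar> powr (t - 1) * \<bar>b\<bar> \<le> (2 * \<bar>b\<bar>) powr (t - 1) * \<bar>b\<bar>"
      using t by (intro mult_right_mono powr_mono2) auto
    also have "\<dots> = 2 powr (t - 1) * (\<bar>b\<bar> powr (t - 1) * \<bar>b\<bar>)" by (simp add: powr_mult)
    also have "\<bar>b\<bar> powr (t - 1) * \<bar>b\<bar> = \<bar>b\<bar> powr t"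
      using t by (cases "b = 0") (auto simp: powr_diff)
    also have "2 powr (t - 1) * \<bar>b\<bar> powr t \<le> 2 powr P * \<bar>b\<bar> powr t"
      using t by (intro mult_right_mono powr_mono) auto
    finally show ?thesis by (simp add: add_increasing)
  qed
  moreover have "\<bar>a\<bar> powr (t - 2) * a * (a - b) \<ge> \<bar>a\<bar> powr t - \<bar>a\<bar> powr (t - 1) * \<bar>b\<bar>"
  proof -
    have "\<bar>a\<bar> powr (t - 2) * a * (a - b) = \<bar>a\<bar> powr (t - 2) * \<bar>a\<bar> * \<bar>a\<bar> - \<bar>a\<bar> powr (t - 2) * (a * b)"
      by (simp add: algebra_simps)
    moreover have "\<bar>a\<bar> powr (t - 2) * (a * b) \<le> \<bar>a\<bar> powr (t - 2) * \<bar>a\<bar> * \<bar>b\<bar>"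
      unfolding mult.assoc abs_mult[symmetric] by (intro mult_left_mono) auto
    ultimately show ?thesis by (simp add: abs_powr_minus_two_mult aa)
  qed
  \<comment> \<open>Trades the remaining half of \<open>\<bar>a\<bar> powr t\<close> for a power of
    \<open>\<bar>a - b\<bar>\<close>, at the cost of another power of \<open>b\<close>.\<close>
  moreover have "2 powr (- P) * \<bar>a - b\<bar> powr t \<le> \<bar>a\<bar> powr t + \<bar>b\<bar> powr t"
  proof -
    have "\<bar>a - b\<bar> powr t \<le> 2 powr t * (\<bar>a\<bar> powr t + \<bar>b\<bar> powr t)"
      using t by (intro powr_abs_diff_le) auto
    also have "\<dots> \<le> 2 powr P * (\<bar>a\<bar> powr t + \<bar>b\<bar> powr t)"
      using t by (intro mult_right_mono powr_mono) auto
    finally have "2 powr (- P) * \<bar>a - b\<bar> powr t \<le> 2 powr (- P) * (2 powr P * (\<bar>a\<bar> powr t + \<bar>b\<bar> powr t))"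
      by (intro mult_left_mono) auto
    also have "\<dots> = \<bar>a\<bar> powr t + \<bar>b\<bar> powr t"
      by (simp add: mult.assoc[symmetric] powr_add[symmetric])
    finally show ?thesis .
  qed
  ultimately show ?thesis by (simp add: algebra_simps)
qed

text \<open>Integrates the pointwise coercivity. The integrand of the pairing must first be shown
  integrable, since otherwise its integral would be 0 by convention and the comparison would
  fail.\<close>

lemma pairing_lower_bound:
  fixes p :: "'a::euclidean_space \<Rightarrow> 'a \<Rightarrow> real"
  assumes p: "p \<in> sym_exponents" and u: "u \<in> Wsp s p" and g: "g \<in> Wsp s p"
    and v: "(\<lambda>x. u x - g x) \<in> Wsp s p"
  shows "2 powr (- exp_sup p) / 2 * enn2real (gagliardo_modular s p (\<lambda>x. u x - g x)) -
    (1 / 2 + 2 powr exp_sup p) * enn2real (gagliardo_modular s p g) \<le> pairing s p u (\<lambda>x. u x - g x)"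
proof -
  note pb = sym_exponents_bounds[OF p]
  define v where "v = (\<lambda>x. u x - g x)"
  define c where "c = 2 powr (- exp_sup p) / 2"
  define C where "C = 1 / 2 + 2 powr exp_sup p"
  define F where "F = (\<lambda>(x, y). \<bar>u x - u y\<bar> powr (p x y - 2) * (u x - u y) * (v x - v y) /
    norm (x - y) powr (real DIM('a) + s * p x y))"
  have vW: "v \<in> Wsp s p" using v by (simp add: v_def)
  note iu = gagliardo_integrable[OF pb(4) Wsp_measurable[OF u], of s]
  note ig = gagliardo_integrable[OF pb(4) Wsp_measurable[OF g], of s]
  note iv = gagliardo_integrable[OF pb(4) Wsp_measurable[OF vW], of s]
  have fin: "gagliardo_modular s p u < \<infinity>" "gagliardo_modular s p g < \<infinity>" "gagliardo_modular s p v < \<infinity>"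
    using u g vW by (auto simp: Wsp_iff)
  have Fm: "F \<in> borel_measurable (lebesgue \<Otimes>\<^sub>M lebesgue)"
  proof -
    note [measurable] = exponent_measurable_pair_lebesgue[OF pb(4)]
      diff_measurable_pair_lebesgue[OF Wsp_measurable[OF u]]
      diff_measurable_pair_lebesgue[OF Wsp_measurable[OF vW]] norm_diff_measurable_pair_lebesgue
    show ?thesis unfolding F_def split_beta by measurable
  qed
  have Fbound: "\<bar>F z\<bar> \<le> gagliardo_integrand s p u z + gagliardo_integrand s p v z" for z
  proof -
    obtain x y where z: "z = (x, y)" by force
    have "\<bar>u x - u y\<bar> powr (p x y - 1) * \<bar>v x - v y\<bar> \<le> \<bar>u x - u y\<bar> powr p x y + \<bar>v x - v y\<bar> powr p x y"
      using pb(1)[of x y] pb(3) by (intro powr_times_le_add_powr) auto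
    then show ?thesis
      unfolding z F_def gagliardo_integrand_def prod.case add_divide_distrib[symmetric]
      by (simp add: abs_mult abs_powr_minus_two_mult divide_right_mono)
  qed
  have Fi: "integrable (lebesgue \<Otimes>\<^sub>M lebesgue) F"
    by (rule Bochner_Integration.integrable_bound[OF Bochner_Integration.integrable_add[OF iu(1)[OF fin(1)] iv(1)[OF fin(3)]] Fm])
      (use Fbound in \<open>force simp: gagliardo_integrand_nonneg\<close>)
  have low: "c * gagliardo_integrand s p v z - C * gagliardo_integrand s p g z \<le> F z" for z
  proof -
    obtain x y where z: "z = (x, y)" by force
    have vd: "v x - v y = (u x - u y) - (g x - g y)" by (simp add: v_def)
    have "c * \<bar>v x - v y\<bar> powr p x y - C * \<bar>g x - g y\<bar> powr p x y
        \<le> \<bar>u x - u y\<bar> powr (p x y - 2) * (u x - u y) * (v x - v y)"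
      unfolding vd c_def C_def using pb(1)[of x y] pb(2)[of x y] pb(3)
      by (intro monotone_flux_lower_bound) auto
    from divide_right_mono[OF this, of "norm (x - y) powr (real DIM('a) + s * p x y)"]
    show ?thesis
      unfolding z F_def gagliardo_integrand_def prod.case by (simp add: diff_divide_distrib)
  qed
  have "(\<integral>z. c * gagliardo_integrand s p v z - C * gagliardo_integrand s p g z \<partial>(lebesgue \<Otimes>\<^sub>M lebesgue))
      \<le> (\<integral>z. F z \<partial>(lebesgue \<Otimes>\<^sub>M lebesgue))"
    using ig(1)[OF fin(2)] iv(1)[OF fin(3)] Fi low by (intro integral_mono) auto
  moreover have "(\<integral>z. F z \<partial>(lebesgue \<Otimes>\<^sub>M lebesgue)) = pairing s p u v"
    by (simp add: F_def pairing_def)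
  ultimately show ?thesis
    using ig[OF fin(2)] iv[OF fin(3)] by (simp add: v_def[symmetric] c_def[symmetric] C_def[symmetric])
qed

text \<open>Dividing by \<sigma> \<ge> 1 gains at least the factor with the smallest exponent. This
  normalises a function to modular at most 1.\<close>

lemma gagliardo_modular_scale:
  assumes p: "p \<in> sym_exponents" and u: "u \<in> borel_measurable lebesgue" and \<sigma>: "1 \<le> \<sigma>"
  shows "gagliardo_modular s p (\<lambda>x. u x / \<sigma>) \<le> ennreal (\<sigma> powr (- exp_inf p)) * gagliardo_modular s p u"
proof -
  note pb = sym_exponents_bounds[OF p]
  have "gagliardo_integrand s p (\<lambda>x. u x / \<sigma>) z \<le> \<sigma> powr (- exp_inf p) * gagliardo_integrand s p u z" for z
  proof -
    obtain x y where z: "z = (x, y)" by force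
    have "\<bar>u x / \<sigma> - u y / \<sigma>\<bar> = \<bar>u x - u y\<bar> * inverse \<sigma>"
      using \<sigma> by (subst diff_divide_distrib[symmetric]) (simp add: divide_inverse abs_mult)
    then have "\<bar>u x / \<sigma> - u y / \<sigma>\<bar> powr p x y = \<bar>u x - u y\<bar> powr p x y * \<sigma> powr (- p x y)"
      using \<sigma> by (simp add: powr_mult powr_minus inverse_powr)
    also have "\<dots> \<le> \<bar>u x - u y\<bar> powr p x y * \<sigma> powr (- exp_inf p)"
      using \<sigma> pb(1) by (intro mult_left_mono powr_mono) auto
    finally have "\<bar>u x / \<sigma> - u y / \<sigma>\<bar> powr p x y \<le> \<sigma> powr (- exp_inf p) * \<bar>u x - u y\<bar> powr p x y"
      by (simp add: mult.commute)
    from divide_right_mono[OF this] show ?thesis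
      unfolding z gagliardo_integrand_def prod.case by simp
  qed
  then have "gagliardo_modular s p (\<lambda>x. u x / \<sigma>) \<le>
      (\<integral>\<^sup>+z. ennreal (\<sigma> powr (- exp_inf p)) * ennreal (gagliardo_integrand s p u z) \<partial>(lebesgue \<Otimes>\<^sub>M lebesgue))"
    unfolding gagliardo_modular_def
    by (intro nn_integral_mono) (auto simp: ennreal_mult'[symmetric] intro!: ennreal_leI)
  also have "\<dots> = ennreal (\<sigma> powr (- exp_inf p)) * gagliardo_modular s p u"
    unfolding gagliardo_modular_def using gagliardo_integrand_measurable[OF pb(4) u]
    by (intro nn_integral_cmult) measurable
  finally show ?thesis .
qed

section \<open>Luxemburg norms\<close>

lemma lux_norm_le:
  assumes "0 < l" "(\<integral>\<^sup>+x. ennreal (\<bar>u x / l\<bar> powr q x) \<partial>lebesgue_on U) \<le> 1"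
  shows "lux_norm q U u \<le> l"
  unfolding lux_norm_def using assms by (intro cInf_lower) (auto intro!: bdd_belowI[of _ 0])

text \<open>The admissible \<open>l\<close> is essential: it excludes the infimum of the empty
  set.\<close>

lemma lux_norm_nonneg:
  assumes "0 < l" "(\<integral>\<^sup>+x. ennreal (\<bar>u x / l\<bar> powr q x) \<partial>lebesgue_on U) \<le> 1"
  shows "0 \<le> lux_norm q U u"
  unfolding lux_norm_def using assms by (intro cInf_greatest) auto

text \<open>For \<open>C \<ge> 1\<close> and exponents at least 1, division by \<open>C\<close>
  gains at least a factor \<open>1 / C\<close>. Thus a modular bound becomes a bound for the
  Luxemburg norm.\<close>

lemma modular_scale_le_one:
  assumes u: "u \<in> borel_measurable (lebesgue_on U)" and q: "q \<in> borel_measurable (lebesgue_on U)"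
    "\<And>x. x \<in> U \<Longrightarrow> 1 \<le> q x"
    and C: "1 \<le> C" "(\<integral>\<^sup>+x. ennreal (\<bar>u x\<bar> powr q x) \<partial>lebesgue_on U) \<le> ennreal C"
  shows "(\<integral>\<^sup>+x. ennreal (\<bar>u x / C\<bar> powr q x) \<partial>lebesgue_on U) \<le> 1"
proof -
  have "(\<integral>\<^sup>+x. ennreal (\<bar>u x / C\<bar> powr q x) \<partial>lebesgue_on U) \<le>
      (\<integral>\<^sup>+x. ennreal (1 / C) * ennreal (\<bar>u x\<bar> powr q x) \<partial>lebesgue_on U)"
  proof (intro nn_integral_mono)
    fix x assume "x \<in> space (lebesgue_on U)"
    then have x: "1 \<le> q x" using q(2) by simp
    have "\<bar>u x / C\<bar> = \<bar>u x\<bar> * inverse C" using C by (simp add: divide_inverse abs_mult)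
    then have "\<bar>u x / C\<bar> powr q x = \<bar>u x\<bar> powr q x * C powr (- q x)"
      using C by (simp add: powr_mult powr_minus inverse_powr)
    also have "\<dots> \<le> \<bar>u x\<bar> powr q x * C powr (- 1)"
      using C x by (intro mult_left_mono powr_mono) auto
    also have "C powr (- 1) = 1 / C" using C by (simp add: powr_minus divide_inverse)
    finally show "ennreal (\<bar>u x / C\<bar> powr q x) \<le> ennreal (1 / C) * ennreal (\<bar>u x\<bar> powr q x)"
      using C by (subst ennreal_mult'[symmetric]) (auto intro!: ennreal_leI simp: mult.commute)
  qed
  also have "\<dots> = ennreal (1 / C) * (\<integral>\<^sup>+x. ennreal (\<bar>u x\<bar> powr q x) \<partial>lebesgue_on U)"
    using u q(1) by (intro nn_integral_cmult) measurable
  also have "\<dots> \<le> ennreal (1 / C) * ennreal C" using C by (intro mult_left_mono) auto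
  also have "\<dots> = 1" using C by (subst ennreal_mult'[symmetric]) auto
  finally show ?thesis .
qed

text \<open>Some admissible \<open>k\<close> lies below \<open>l\<close>, and the modular decreases
  as the divisor grows. Working strictly above the norm avoids asking whether the infimum is
  attained or is 0.\<close>

lemma modular_le_one_above_lux_norm:
  assumes u: "u \<in> Lvar q U" and q: "q \<in> borel_measurable (lebesgue_on U)"
    "\<And>x. x \<in> U \<Longrightarrow> 1 \<le> q x" and l: "lux_norm q U u < l"
  shows "0 \<le> lux_norm q U u" "(\<integral>\<^sup>+x. ennreal (\<bar>u x / l\<bar> powr q x) \<partial>lebesgue_on U) \<le> 1"
proof -
  \<comment> \<open>A finite modular supplies an admissible divisor, so the set in the definition of
    the norm is nonempty.\<close>
  define C where "C = max 1 (enn2real (\<integral>\<^sup>+x. ennreal (\<bar>u x\<bar> powr q x) \<partial>lebesgue_on U))"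
  have um: "u \<in> borel_measurable (lebesgue_on U)"
    and fin: "(\<integral>\<^sup>+x. ennreal (\<bar>u x\<bar> powr q x) \<partial>lebesgue_on U) < \<infinity>"
    using u by (auto simp: Lvar_def)
  have "(\<integral>\<^sup>+x. ennreal (\<bar>u x\<bar> powr q x) \<partial>lebesgue_on U) =
      ennreal (enn2real (\<integral>\<^sup>+x. ennreal (\<bar>u x\<bar> powr q x) \<partial>lebesgue_on U))"
    using fin by simp
  also have "\<dots> \<le> ennreal C" unfolding C_def by (intro ennreal_leI) simp
  finally have "(\<integral>\<^sup>+x. ennreal (\<bar>u x / C\<bar> powr q x) \<partial>lebesgue_on U) \<le> 1"
    by (intro modular_scale_le_one um q) (auto simp: C_def)
  moreover have "0 < C" by (simp add: C_def)
  ultimately have ne: "C \<in> {l. l > 0 \<and> (\<integral>\<^sup>+x. ennreal (\<bar>u x / l\<bar> powr q x) \<partial>lebesgue_on U) \<le> 1}"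
    and "0 \<le> lux_norm q U u"
    by (auto intro: lux_norm_nonneg)
  then show "0 \<le> lux_norm q U u" by simp
  obtain k where k: "k > 0" "k < l" "(\<integral>\<^sup>+x. ennreal (\<bar>u x / k\<bar> powr q x) \<partial>lebesgue_on U) \<le> 1"
    using cInf_lessD[OF _ l[unfolded lux_norm_def]] ne by blast
  have "(\<integral>\<^sup>+x. ennreal (\<bar>u x / l\<bar> powr q x) \<partial>lebesgue_on U) \<le>
      (\<integral>\<^sup>+x. ennreal (\<bar>u x / k\<bar> powr q x) \<partial>lebesgue_on U)"
  proof (intro nn_integral_mono ennreal_leI powr_mono2)
    fix x assume "x \<in> space (lebesgue_on U)"
    then show "0 \<le> q x" using q(2)[of x] by simp
    show "\<bar>u x / l\<bar> \<le> \<bar>u x / k\<bar>" using k by (simp add: frac_le)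
  qed simp
  with k(3) show "(\<integral>\<^sup>+x. ennreal (\<bar>u x / l\<bar> powr q x) \<partial>lebesgue_on U) \<le> 1" by (rule order_trans[rotated])
qed

text \<open>Young's inequality is applied pointwise to \<open>h / H\<close> and
  \<open>v / T\<close>. Both weights are at most 1, and the two modulars together give the factor
  2.\<close>

lemma variable_Holder_bound:
  fixes h v r :: "'a::euclidean_space \<Rightarrow> real"
  assumes h: "h \<in> borel_measurable (lebesgue_on U)" and v: "v \<in> borel_measurable (lebesgue_on U)"
    and r: "r \<in> borel_measurable (lebesgue_on U)" "\<And>x. x \<in> U \<Longrightarrow> 1 < r x"
    and HT: "0 < H" "0 < T"
    and mh: "(\<integral>\<^sup>+x. ennreal (\<bar>h x / H\<bar> powr conj_exponent r x) \<partial>lebesgue_on U) \<le> 1"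
    and mv: "(\<integral>\<^sup>+x. ennreal (\<bar>v x / T\<bar> powr r x) \<partial>lebesgue_on U) \<le> 1"
  shows "\<bar>\<integral>x. h x * v x \<partial>lebesgue_on U\<bar> \<le> 2 * H * T"
proof (cases "integrable (lebesgue_on U) (\<lambda>x. h x * v x)")
  \<comment> \<open>A Bochner integral that does not exist is 0 by convention.\<close>
  case False
  then show ?thesis using HT by (simp add: not_integrable_integral_eq)
next
  case True
  have rm: "conj_exponent r \<in> borel_measurable (lebesgue_on U)"
    unfolding conj_exponent_def[abs_def] using r(1) by measurable
  have "ennreal \<bar>\<integral>x. h x * v x \<partial>lebesgue_on U\<bar> \<le> (\<integral>\<^sup>+x. ennreal \<bar>h x * v x\<bar> \<partial>lebesgue_on U)"
    using integral_norm_bound_ennreal[OF True] by simp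
  also have "\<dots> \<le> (\<integral>\<^sup>+x. ennreal (H * T) * (ennreal (\<bar>h x / H\<bar> powr conj_exponent r x) +
      ennreal (\<bar>v x / T\<bar> powr r x)) \<partial>lebesgue_on U)"
  proof (intro nn_integral_mono)
    fix x assume "x \<in> space (lebesgue_on U)"
    then have x: "1 < r x" using r(2) by simp
    have c: "1 < conj_exponent r x" using x by (simp add: conj_exponent_def)
    define a where "a = \<bar>h x / H\<bar> powr conj_exponent r x"
    define b where "b = \<bar>v x / T\<bar> powr r x"
    have "\<bar>h x / H\<bar> * \<bar>v x / T\<bar> \<le> a / conj_exponent r x + b / r x"
      unfolding a_def b_def using x c conj_exponent_eq[of r x]
      by (intro Youngs_inequality) auto
    also have "a / conj_exponent r x + b / r x \<le> a + b"
      using x c divide_left_mono[of 1 "r x" b] divide_left_mono[of 1 "conj_exponent r x" a]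
      by (intro add_mono) (auto simp: a_def b_def)
    finally have "(H * T) * (\<bar>h x / H\<bar> * \<bar>v x / T\<bar>) \<le> (H * T) * (a + b)"
      using HT by (intro mult_left_mono) auto
    then have "\<bar>h x * v x\<bar> \<le> (H * T) * (a + b)"
      using HT by (simp add: abs_mult field_simps)
    then have "ennreal \<bar>h x * v x\<bar> \<le> ennreal ((H * T) * (a + b))" by (rule ennreal_leI)
    also have "\<dots> = ennreal (H * T) * (ennreal a + ennreal b)"
      using HT by (simp add: ennreal_mult' a_def b_def)
    finally show "ennreal \<bar>h x * v x\<bar> \<le> ennreal (H * T) *
        (ennreal (\<bar>h x / H\<bar> powr conj_exponent r x) + ennreal (\<bar>v x / T\<bar> powr r x))"
      by (simp add: a_def b_def)
  qed
  also have "\<dots> = ennreal (H * T) * ((\<integral>\<^sup>+x. ennreal (\<bar>h x / H\<bar> powr conj_exponent r x) \<partial>lebesgue_on U) +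
      (\<integral>\<^sup>+x. ennreal (\<bar>v x / T\<bar> powr r x) \<partial>lebesgue_on U))"
    using h v r(1) rm by (subst nn_integral_cmult) (auto simp: nn_integral_add)
  also have "\<dots> \<le> ennreal (H * T) * (1 + 1)"
    using mh mv by (intro mult_left_mono add_mono) auto
  also have "\<dots> = ennreal (2 * H * T)"
  proof -
    have "ennreal (H * T) * (1 + 1) = ennreal (H * T) * ennreal 2" by simp
    also have "\<dots> = ennreal (2 * H * T)" using HT by (subst ennreal_mult'[symmetric]) (auto simp: mult_ac)
    finally show ?thesis .
  qed
  finally show ?thesis using HT by simp
qed

section \<open>Embedding of the fractional Sobolev space\<close>

lemma nn_integral_lebesgue_on_le:
  assumes "\<Omega> \<in> sets lebesgue" "\<Omega> \<subseteq> S"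
  shows "(\<integral>\<^sup>+x. f x \<partial>lebesgue_on \<Omega>) \<le> (\<integral>\<^sup>+x. f x * indicator S x \<partial>lebesgue)"
proof -
  have "(\<integral>\<^sup>+x. f x \<partial>lebesgue_on \<Omega>) = (\<integral>\<^sup>+x. f x * indicator \<Omega> x \<partial>lebesgue)"
    using assms(1) by (intro nn_integral_restrict_space) auto
  also have "\<dots> \<le> (\<integral>\<^sup>+x. f x * indicator S x \<partial>lebesgue)"
    using assms(2) by (intro nn_integral_mono) (auto split: split_indicator)
  finally show ?thesis .
qed

text \<open>No boundary condition is available here, so the iteration starts from Chebyshev's
  inequality in the diagonal exponent. It makes the norms of \<open>g\<close> and \<open>u\<close>
  meaningful.\<close>

lemma Wsp_subset_Lvar:
  fixes p :: "'a::euclidean_space \<Rightarrow> 'a \<Rightarrow> real" and r :: "'a \<Rightarrow> real"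
  assumes p: "p \<in> sym_exponents" and s: "0 < s" "s * exp_sup p < real DIM('a)"
    and \<Omega>: "bounded \<Omega>" "\<Omega> \<in> sets lebesgue"
    and r: "continuous_on (closure \<Omega>) r" "\<And>x. x \<in> closure \<Omega> \<Longrightarrow> 0 \<le> r x"
      "\<And>x. x \<in> closure \<Omega> \<Longrightarrow> r x < crit_exp s p x"
  shows "Wsp s p \<subseteq> Lvar r \<Omega>"
proof
  fix u assume u: "u \<in> Wsp s p"
  have um: "u \<in> borel_measurable lebesgue" by (rule Wsp_measurable[OF u])
  have pb: "1 \<le> diag_exp p x" for x
    using sym_exponents_bounds(1)[OF p, of x x] sym_exponents_bounds(3)[OF p] by (simp add: diag_exp_def)
  obtain M1 where M1: "M1 \<ge> 0" "\<forall>l\<ge>1. emeasure lebesgue {x. l < \<bar>u x\<bar>} \<le> ennreal (M1 / l)"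
    using Lvar_level_set_bound[of u "diag_exp p"] u pb by (auto simp: Wsp_iff)
  define M where "M = max M1 (enn2real (gagliardo_modular s p u))"
  have "gagliardo_modular s p u = ennreal (enn2real (gagliardo_modular s p u))"
    using u by (simp add: Wsp_iff)
  also have "\<dots> \<le> ennreal M" by (intro ennreal_leI) (simp add: M_def)
  finally have 1: "gagliardo_modular s p u \<le> ennreal M" .
  have 2: "\<forall>l\<ge>1. emeasure lebesgue {x. l < \<bar>u x\<bar>} \<le> ennreal (M / l)"
  proof (intro allI impI)
    fix l :: real assume l: "1 \<le> l"
    have "M1 / l \<le> M / l" using l by (intro divide_right_mono) (auto simp: M_def)
    then show "emeasure lebesgue {x. l < \<bar>u x\<bar>} \<le> ennreal (M / l)"
      using M1(2) l ennreal_leI order_trans by blast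
  qed
  have M0: "M \<ge> 0" using M1 by (simp add: M_def)
  have "compact (closure \<Omega>)" using \<Omega> by (simp add: compact_closure)
  from compact_embedding_bound[OF p s this r M0] um 1 2
  obtain C where "(\<integral>\<^sup>+x. ennreal (\<bar>u x\<bar> powr r x) * indicator (closure \<Omega>) x \<partial>lebesgue) \<le> ennreal C"
    by blast
  then have "(\<integral>\<^sup>+x. ennreal (\<bar>u x\<bar> powr r x) \<partial>lebesgue_on \<Omega>) < \<infinity>"
    using nn_integral_lebesgue_on_le[OF \<Omega>(2) closure_subset]
    by (metis ennreal_less_top infinity_ennreal_def le_less_trans)
  moreover have "u \<in> borel_measurable (lebesgue_on \<Omega>)"
    using um by (rule measurable_restrict_space1)
  ultimately show "u \<in> Lvar r \<Omega>" by (simp add: Lvar_def)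
qed

text \<open>Here the weak bound comes from the interaction with a ball outside \<Omega>, hence from
  the modular alone. The constant is therefore common to all admissible \<open>v\<close>.\<close>

lemma vanishing_outside_embedding:
  fixes p :: "'a::euclidean_space \<Rightarrow> 'a \<Rightarrow> real" and r :: "'a \<Rightarrow> real"
  assumes p: "p \<in> sym_exponents" and s: "0 < s" "s * exp_sup p < real DIM('a)"
    and \<Omega>: "bounded \<Omega>" "\<Omega> \<in> sets lebesgue"
    and r: "continuous_on (closure \<Omega>) r" "\<And>x. x \<in> closure \<Omega> \<Longrightarrow> 0 \<le> r x"
      "\<And>x. x \<in> closure \<Omega> \<Longrightarrow> r x < crit_exp s p x"
  shows "\<exists>C\<ge>1. \<forall>v\<in>borel_measurable lebesgue. (AE x in lebesgue. x \<notin> \<Omega> \<longrightarrow> v x = 0) \<longrightarrow>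
    gagliardo_modular s p v \<le> 1 \<longrightarrow> (\<integral>\<^sup>+x. ennreal (\<bar>v x\<bar> powr r x) \<partial>lebesgue_on \<Omega>) \<le> ennreal C"
proof -
  note pb = sym_exponents_bounds[OF p]
  have "1 \<le> p x y" for x y using pb(1)[of x y] pb(3) by linarith
  from vanishing_outside_level_set_bound[OF \<Omega> pb(4) this pb(2) s(1)]
  obtain M1 where M1: "M1 \<ge> 0" "\<And>u l. u \<in> borel_measurable lebesgue \<Longrightarrow>
      (AE x in lebesgue. x \<notin> \<Omega> \<longrightarrow> u x = 0) \<Longrightarrow> gagliardo_modular s p u \<le> 1 \<Longrightarrow> 1 \<le> l \<Longrightarrow>
      emeasure lebesgue {x. l < \<bar>u x\<bar>} \<le> ennreal (M1 / l)"
    by blast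
  define M where "M = max 1 M1"
  have M0: "M \<ge> 0" by (simp add: M_def)
  have "compact (closure \<Omega>)" using \<Omega> by (simp add: compact_closure)
  from compact_embedding_bound[OF p s this r M0]
  obtain C where C: "\<And>u. u \<in> borel_measurable lebesgue \<Longrightarrow> gagliardo_modular s p u \<le> ennreal M \<Longrightarrow>
      \<forall>l\<ge>1. emeasure lebesgue {x. l < \<bar>u x\<bar>} \<le> ennreal (M / l) \<Longrightarrow>
      (\<integral>\<^sup>+x. ennreal (\<bar>u x\<bar> powr r x) * indicator (closure \<Omega>) x \<partial>lebesgue) \<le> ennreal C"
    by blast
  have "(\<integral>\<^sup>+x. ennreal (\<bar>v x\<bar> powr r x) \<partial>lebesgue_on \<Omega>) \<le> ennreal (max 1 C)"
    if v: "v \<in> borel_measurable lebesgue" "AE x in lebesgue. x \<notin> \<Omega> \<longrightarrow> v x = 0"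
      "gagliardo_modular s p v \<le> 1" for v
  proof -
    have "ennreal 1 \<le> ennreal M" by (intro ennreal_leI) (simp add: M_def)
    then have 1: "gagliardo_modular s p v \<le> ennreal M" using v(3) by (metis ennreal_1 order_trans)
    have 2: "\<forall>l\<ge>1. emeasure lebesgue {x. l < \<bar>v x\<bar>} \<le> ennreal (M / l)"
    proof (intro allI impI)
      fix l :: real assume l: "1 \<le> l"
      have "M1 / l \<le> M / l" using l by (intro divide_right_mono) (auto simp: M_def)
      then show "emeasure lebesgue {x. l < \<bar>v x\<bar>} \<le> ennreal (M / l)"
        using M1(2)[OF v l] ennreal_leI order_trans by blast
    qed
    have "(\<integral>\<^sup>+x. ennreal (\<bar>v x\<bar> powr r x) \<partial>lebesgue_on \<Omega>) \<le>
        (\<integral>\<^sup>+x. ennreal (\<bar>v x\<bar> powr r x) * indicator (closure \<Omega>) x \<partial>lebesgue)"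
      by (rule nn_integral_lebesgue_on_le[OF \<Omega>(2) closure_subset])
    also have "\<dots> \<le> ennreal C" by (rule C[OF v(1) 1 2])
    also have "\<dots> \<le> ennreal (max 1 C)" by (intro ennreal_leI) simp
    finally show ?thesis .
  qed
  then show ?thesis by (intro exI[of _ "max 1 C"]) auto
qed

text \<open>Stands in for the triangle inequality of the Luxemburg norm. Of the factor 4, one 2 pays
  for bounding a sum by twice a maximum, and the other halves the sum of the two modulars, as
  \<open>r \<ge> 1\<close>.\<close>

lemma modular_add_le_one:
  assumes v: "v \<in> borel_measurable (lebesgue_on U)" and g: "g \<in> borel_measurable (lebesgue_on U)"
    and r: "r \<in> borel_measurable (lebesgue_on U)" "\<And>x. x \<in> U \<Longrightarrow> 1 \<le> r x"
    and T: "0 < T" "T \<le> X" and G: "0 < G" "G \<le> X"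
    and mv: "(\<integral>\<^sup>+x. ennreal (\<bar>v x / T\<bar> powr r x) \<partial>lebesgue_on U) \<le> 1"
    and mg: "(\<integral>\<^sup>+x. ennreal (\<bar>g x / G\<bar> powr r x) \<partial>lebesgue_on U) \<le> 1"
  shows "(\<integral>\<^sup>+x. ennreal (\<bar>(v x + g x) / (4 * X)\<bar> powr r x) \<partial>lebesgue_on U) \<le> 1"
proof -
  have "(\<integral>\<^sup>+x. ennreal (\<bar>(v x + g x) / (4 * X)\<bar> powr r x) \<partial>lebesgue_on U) \<le>
      (\<integral>\<^sup>+x. ennreal (1 / 2) * (ennreal (\<bar>v x / T\<bar> powr r x) + ennreal (\<bar>g x / G\<bar> powr r x)) \<partial>lebesgue_on U)"
  proof (intro nn_integral_mono)
    fix x assume "x \<in> space (lebesgue_on U)"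
    then have x: "1 \<le> r x" using r(2) by simp
    define a where "a = \<bar>v x / T\<bar>"
    define b where "b = \<bar>g x / G\<bar>"
    have 1: "\<bar>v x\<bar> / X \<le> a" "\<bar>g x\<bar> / X \<le> b" using T G by (auto simp: a_def b_def frac_le)
    have "\<bar>(v x + g x) / (4 * X)\<bar> \<le> (\<bar>v x\<bar> + \<bar>g x\<bar>) / (4 * X)"
      using T by (simp add: abs_divide divide_right_mono)
    also have "\<dots> = (1 / 4) * (\<bar>v x\<bar> / X + \<bar>g x\<bar> / X)" by (simp add: add_divide_distrib)
    also have "\<dots> \<le> (1 / 4) * (max a b + max a b)"
      using 1 by (intro mult_left_mono add_mono) auto
    also have "\<dots> = (1 / 2) * max a b" by simp
    finally have "\<bar>(v x + g x) / (4 * X)\<bar> powr r x \<le> ((1 / 2) * max a b) powr r x"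
      using x by (intro powr_mono2) auto
    also have "\<dots> = (1 / 2) powr r x * max a b powr r x"
      by (intro powr_mult)
    also have "\<dots> \<le> (1 / 2) * (a powr r x + b powr r x)"
    proof (intro mult_mono)
      have "(1 / 2 :: real) powr r x \<le> (1 / 2) powr 1" using x by (intro powr_mono') auto
      then show "(1 / 2 :: real) powr r x \<le> 1 / 2" by simp
      show "max a b powr r x \<le> a powr r x + b powr r x" by (auto simp: max_def)
    qed auto
    finally have "ennreal (\<bar>(v x + g x) / (4 * X)\<bar> powr r x) \<le> ennreal ((1 / 2) * (a powr r x + b powr r x))"
      by (rule ennreal_leI)
    also have "\<dots> = ennreal (1 / 2) * (ennreal (a powr r x) + ennreal (b powr r x))"
      by (subst ennreal_mult') auto
    finally show "ennreal (\<bar>(v x + g x) / (4 * X)\<bar> powr r x) \<le>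
        ennreal (1 / 2) * (ennreal (\<bar>v x / T\<bar> powr r x) + ennreal (\<bar>g x / G\<bar> powr r x))"
      by (simp add: a_def b_def)
  qed
  also have "\<dots> = ennreal (1 / 2) * ((\<integral>\<^sup>+x. ennreal (\<bar>v x / T\<bar> powr r x) \<partial>lebesgue_on U) +
      (\<integral>\<^sup>+x. ennreal (\<bar>g x / G\<bar> powr r x) \<partial>lebesgue_on U))"
    using v g r(1) by (subst nn_integral_cmult) (auto simp: nn_integral_add)
  also have "\<dots> \<le> ennreal (1 / 2) * (1 + 1)" using mv mg by (intro mult_left_mono add_mono) auto
  also have "\<dots> = ennreal (1 / 2) * ennreal 2" by simp
  also have "\<dots> = 1" by (subst ennreal_mult'[symmetric]) auto
  finally show ?thesis .
qed

section \<open>The a priori bound\<close>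

theorem theorem17:
  fixes \<Omega> :: "'a::euclidean_space set"
    and s :: real
    and p :: "'a \<Rightarrow> 'a \<Rightarrow> real"
    and r g :: "'a \<Rightarrow> real"
  assumes "bounded_smooth_domain \<Omega>"
    and "0 < s" and "s < 1"
    and "p \<in> sym_exponents"
    and "s * exp_sup p < real DIM('a)"
    and "r \<in> C_plus (closure \<Omega>)"
    and "\<And>x. x \<in> closure \<Omega> \<Longrightarrow> r x < crit_exp s p x"
    and "g \<in> Wsp s p"
  shows "\<exists>K1>0. \<exists>K2>0. \<forall>h \<in> Lvar (conj_exponent r) \<Omega>. \<forall>u. weak_solution s p \<Omega> g h u \<longrightarrow>
    u \<in> Lvar r \<Omega> \<and>
    (\<forall>x y. lux_norm r \<Omega> u powr (p x y - 1)
       \<le> K1 + K2 * lux_norm (conj_exponent r) \<Omega> h powr ((exp_sup p - 1) / (exp_inf p - 1)))"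
proof -
  note p = \<open>p \<in> sym_exponents\<close> and g = \<open>g \<in> Wsp s p\<close>
  note pb = sym_exponents_bounds[OF p]
  have \<Omega>: "bounded \<Omega>" "\<Omega> \<in> sets lebesgue"
    using assms(1) by (auto simp: bounded_smooth_domain_def)
  have rc: "continuous_on (closure \<Omega>) r" using assms(6) by (simp add: C_plus_def)
  have r1: "1 < r x" if "x \<in> closure \<Omega>" for x
  proof -
    have "Inf (r ` closure \<Omega>) \<le> r x"
      using assms(6) that by (intro cInf_lower) (auto simp: C_plus_def)
    then show ?thesis using assms(6) by (simp add: C_plus_def)
  qed
  then have r0: "0 \<le> r x" if "x \<in> closure \<Omega>" for x using that by force
  have r1': "1 < r x" if "x \<in> \<Omega>" for x using r1 that closure_subset by blast
  then have r1'': "1 \<le> r x" if "x \<in> \<Omega>" for x using that by force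
  have rm: "r \<in> borel_measurable (lebesgue_on \<Omega>)"
    using continuous_on_subset[OF rc closure_subset] \<Omega>(2)
    by (rule continuous_imp_measurable_on_sets_lebesgue)
  have cm: "conj_exponent r \<in> borel_measurable (lebesgue_on \<Omega>)"
    unfolding conj_exponent_def[abs_def] using rm by measurable
  have c1: "1 \<le> conj_exponent r x" if "x \<in> \<Omega>" for x
    using r1'[OF that] by (simp add: conj_exponent_def)
  have WL: "w \<in> Lvar r \<Omega>" if "w \<in> Wsp s p" for w
    using Wsp_subset_Lvar[OF p assms(2,5) \<Omega> rc r0 assms(7)] that by blast
  obtain C where C: "1 \<le> C" "\<And>v. v \<in> borel_measurable lebesgue \<Longrightarrow>
      AE x in lebesgue. x \<notin> \<Omega> \<longrightarrow> v x = 0 \<Longrightarrow> gagliardo_modular s p v \<le> 1 \<Longrightarrow>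
      (\<integral>\<^sup>+x. ennreal (\<bar>v x\<bar> powr r x) \<partial>lebesgue_on \<Omega>) \<le> ennreal C"
    using vanishing_outside_embedding[OF p assms(2,5) \<Omega> rc r0 assms(7)] by blast
  \<comment> \<open>The added 1 puts \<open>G\<close> strictly above the norm and makes it at least
    1.\<close>
  define G where "G = lux_norm r \<Omega> g + 1"
  have Gl: "lux_norm r \<Omega> g < G" by (simp add: G_def)
  note Gm = modular_le_one_above_lux_norm[OF WL[OF g] rm r1'' Gl]
  have G: "1 \<le> G" using Gm(1) by (simp add: G_def)
  define c where "c = 2 powr (- exp_sup p) / 2"
  define A where "A = (1 / 2 + 2 powr exp_sup p) * enn2real (gagliardo_modular s p g)"
  \<comment> \<open>Collects the 1 from \<open>\<sigma> powr exp_inf p \<le> 1 + m\<close>, the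
    energy of \<open>g\<close>, and the constant part of the Holder bound with \<open>H + 1\<close>
    in place of \<open>H\<close>.\<close>
  define B0 where "B0 = 1 + A / c + 2 * C / c"
  define B1 where "B1 = 2 * C / c"
  define K where "K = 4 * C * G"
  define e where "e = (exp_sup p - 1) / (exp_inf p - 1)"
  define P where "P = exp_sup p - 1"
  have c: "c > 0" by (simp add: c_def)
  have A: "A \<ge> 0" unfolding A_def by (intro mult_nonneg_nonneg add_nonneg_nonneg) auto
  have B0: "B0 \<ge> 1" using A c C(1) by (simp add: B0_def)
  have B1: "B1 > 0" using c C(1) by (simp add: B1_def)
  have CG: "1 \<le> C * G" using mult_mono[OF C(1) G] C(1) by simp
  have K: "K \<ge> 1" using CG by (simp add: K_def)
  have P: "P > 0" using pb(1)[of 0 0] pb(2)[of 0 0] pb(3) by (simp add: P_def)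
  have e: "e > 0" using P pb(3) by (simp add: e_def P_def)
  have main: "u \<in> Lvar r \<Omega> \<and> lux_norm r \<Omega> u powr (p x y - 1) \<le>
      K powr P * 2 powr e * B0 powr e + K powr P * 2 powr e * B1 powr e * lux_norm (conj_exponent r) \<Omega> h powr e"
    if h: "h \<in> Lvar (conj_exponent r) \<Omega>" and u: "weak_solution s p \<Omega> g h u" for h u x y
  proof -
    define v where "v = (\<lambda>x. u x - g x)"
    have uW: "u \<in> Wsp s p" and vW0: "v \<in> W0sp s p \<Omega>"
      using u by (auto simp: weak_solution_def Kg_def v_def)
    have vW: "v \<in> Wsp s p" and v0: "AE x in lebesgue. x \<notin> \<Omega> \<longrightarrow> v x = 0"
      using vW0 by (auto simp: W0sp_def)
    have vm: "v \<in> borel_measurable lebesgue" by (rule Wsp_measurable[OF vW])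
    have vm': "v \<in> borel_measurable (lebesgue_on \<Omega>)" using vm by (rule measurable_restrict_space1)
    have gm': "g \<in> borel_measurable (lebesgue_on \<Omega>)"
      using Wsp_measurable[OF g] by (rule measurable_restrict_space1)
    define m where "m = enn2real (gagliardo_modular s p v)"
    have m: "0 \<le> m" "gagliardo_modular s p v = ennreal m" using vW by (auto simp: m_def Wsp_iff)
    \<comment> \<open>Makes \<open>v / \<sigma>\<close> have modular at most 1; the maximum with 1
      allows the scaling estimate to be used.\<close>
    define \<sigma> where "\<sigma> = max 1 (m powr (1 / exp_inf p))"
    have \<sigma>: "1 \<le> \<sigma>" by (simp add: \<sigma>_def)
    have m_le: "m \<le> \<sigma> powr exp_inf p"
    proof -
      have "m = (m powr (1 / exp_inf p)) powr exp_inf p" using m pb(3) by (simp add: powr_powr)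
      also have "\<dots> \<le> \<sigma> powr exp_inf p" using pb(3) by (intro powr_mono2) (auto simp: \<sigma>_def)
      finally show ?thesis .
    qed
    have \<sigma>_le: "\<sigma> powr exp_inf p \<le> 1 + m"
      using m pb(3) by (auto simp: \<sigma>_def max_def powr_powr)
    have "gagliardo_modular s p (\<lambda>x. v x / \<sigma>) \<le> ennreal (\<sigma> powr (- exp_inf p)) * ennreal m"
      using gagliardo_modular_scale[OF p vm \<sigma>, of s] m by simp
    also have "\<dots> = ennreal (\<sigma> powr (- exp_inf p) * m)" by (simp add: ennreal_mult')
    also have "\<dots> \<le> ennreal 1"
      using m_le \<sigma> by (intro ennreal_leI) (simp add: powr_minus field_simps)
    finally have "gagliardo_modular s p (\<lambda>x. v x / \<sigma>) \<le> 1" by simp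
    moreover have "(\<lambda>x. v x / \<sigma>) \<in> borel_measurable lebesgue" using vm by measurable
    moreover have "AE x in lebesgue. x \<notin> \<Omega> \<longrightarrow> v x / \<sigma> = 0" using v0 by auto
    ultimately have "(\<integral>\<^sup>+x. ennreal (\<bar>v x / \<sigma>\<bar> powr r x) \<partial>lebesgue_on \<Omega>) \<le> ennreal C"
      using C(2) by blast
    then have "(\<integral>\<^sup>+x. ennreal (\<bar>v x / \<sigma> / C\<bar> powr r x) \<partial>lebesgue_on \<Omega>) \<le> 1"
      using vm' rm r1'' C(1) by (intro modular_scale_le_one) auto
    then have mv: "(\<integral>\<^sup>+x. ennreal (\<bar>v x / (C * \<sigma>)\<bar> powr r x) \<partial>lebesgue_on \<Omega>) \<le> 1"
      by (simp add: divide_divide_eq_left mult.commute)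
    have T: "C * \<sigma> > 0" using C(1) \<sigma> by simp
    define H where "H = lux_norm (conj_exponent r) \<Omega> h"
    \<comment> \<open>The shift gives a positive divisor with modular at most 1 even when the norm
      of \<open>h\<close> is 0.\<close>
    have "H < H + 1" by simp
    from modular_le_one_above_lux_norm[OF h cm c1 this[unfolded H_def]]
    have H: "0 \<le> H" and mh: "(\<integral>\<^sup>+x. ennreal (\<bar>h x / (H + 1)\<bar> powr conj_exponent r x) \<partial>lebesgue_on \<Omega>) \<le> 1"
      by (simp_all add: H_def)
    have "h \<in> borel_measurable (lebesgue_on \<Omega>)" using h by (simp add: Lvar_def)
    from variable_Holder_bound[OF this vm' rm r1' _ T mh mv]
    have hv: "\<bar>\<integral>x. h x * v x \<partial>lebesgue_on \<Omega>\<bar> \<le> 2 * (H + 1) * (C * \<sigma>)" using H by simp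
    \<comment> \<open>The equation is tested with \<open>v\<close>, which belongs to
      \<open>W0sp s p \<Omega>\<close>.\<close>
    have "c * m - A \<le> pairing s p u v"
      using pairing_lower_bound[OF p uW g] vW by (simp add: v_def m_def c_def A_def)
    also have "\<dots> = (\<integral>x. h x * v x \<partial>lebesgue_on \<Omega>)"
      using u vW0 by (simp add: weak_solution_def)
    finally have "c * m \<le> A + 2 * (H + 1) * (C * \<sigma>)" using hv by linarith
    then have "m \<le> A / c + B1 * (H + 1) * \<sigma>"
      using c by (simp add: B1_def field_simps)
    with \<sigma>_le have "\<sigma> powr exp_inf p \<le> 1 + A / c + B1 * (H + 1) * \<sigma>" by linarith
    \<comment> \<open>Since \<sigma> \<ge> 1, the constant term also takes a factor \<sigma>, which
      can then be divided out.\<close>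
    also have "\<dots> \<le> (1 + A / c) * \<sigma> + B1 * (H + 1) * \<sigma>"
      using \<sigma> A c mult_left_mono[OF \<sigma>, of "1 + A / c"] by simp
    also have "\<dots> = (B0 + B1 * H) * \<sigma>" by (simp add: B0_def B1_def algebra_simps add_divide_distrib)
    finally have "\<sigma> powr (exp_inf p - 1) \<le> B0 + B1 * H"
      using \<sigma> by (simp add: powr_diff field_simps)
    \<comment> \<open>Raising to the power \<open>e\<close> turns the exponent
      \<open>exp_inf p - 1\<close> into \<open>P\<close>; this produces the exponent of the norm of
      \<open>h\<close> in the claim.\<close>
    then have "(\<sigma> powr (exp_inf p - 1)) powr e \<le> (B0 + B1 * H) powr e"
      using e by (intro powr_mono2) auto
    moreover have "(exp_inf p - 1) * e = P" using pb(3) by (simp add: e_def P_def)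
    ultimately have "\<sigma> powr P \<le> (B0 + B1 * H) powr e" by (simp add: powr_powr)
    also have "\<dots> = \<bar>B0 - (- (B1 * H))\<bar> powr e" using B0 B1 H by simp
    also have "\<dots> \<le> 2 powr e * (\<bar>B0\<bar> powr e + \<bar>- (B1 * H)\<bar> powr e)"
      using e by (intro powr_abs_diff_le) simp
    also have "\<dots> = 2 powr e * (B0 powr e + B1 powr e * H powr e)"
      using B0 B1 H by (simp add: abs_mult powr_mult)
    finally have \<sigma>P: "\<sigma> powr P \<le> 2 powr e * (B0 powr e + B1 powr e * H powr e)" .
    \<comment> \<open>\<open>C * G * \<sigma>\<close> is a common upper bound for the divisors of
      \<open>v\<close> and \<open>g\<close>; four times it is \<open>K * \<sigma>\<close>.\<close>
    have X: "C * \<sigma> \<le> C * G * \<sigma>" "G \<le> C * G * \<sigma>"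
    proof -
      show "C * \<sigma> \<le> C * G * \<sigma>" using C(1) G \<sigma> by (simp add: mult_le_cancel_left)
      have "1 * G * 1 \<le> C * G * \<sigma>" using C(1) G \<sigma> by (intro mult_mono) auto
      then show "G \<le> C * G * \<sigma>" by simp
    qed
    have "(\<integral>\<^sup>+x. ennreal (\<bar>(v x + g x) / (4 * (C * G * \<sigma>))\<bar> powr r x) \<partial>lebesgue_on \<Omega>) \<le> 1"
      using modular_add_le_one[OF vm' gm' rm r1'' T X(1) _ X(2) mv Gm(2)] G by simp
    then have mu: "(\<integral>\<^sup>+x. ennreal (\<bar>u x / (K * \<sigma>)\<bar> powr r x) \<partial>lebesgue_on \<Omega>) \<le> 1"
      by (simp add: v_def K_def mult.assoc)
    \<comment> \<open>With base at least 1, every exponent \<open>p x y - 1\<close> may be replaced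
      by \<open>P\<close>, so one estimate serves all pairs of points.\<close>
    have K\<sigma>: "1 \<le> K * \<sigma>" using mult_mono[OF K \<sigma>] K by simp
    then have "0 < K * \<sigma>" by linarith
    note lu = lux_norm_le[OF this mu] lux_norm_nonneg[OF this mu]
    have "lux_norm r \<Omega> u powr (p x y - 1) \<le> (K * \<sigma>) powr (p x y - 1)"
      using lu pb(1)[of x y] pb(3) by (intro powr_mono2) auto
    also have "\<dots> \<le> (K * \<sigma>) powr P"
      using K\<sigma> pb(2)[of x y] by (intro powr_mono) (auto simp: P_def)
    also have "\<dots> = K powr P * \<sigma> powr P" using K \<sigma> by (simp add: powr_mult)
    also have "\<dots> \<le> K powr P * (2 powr e * (B0 powr e + B1 powr e * H powr e))"
      using \<sigma>P by (intro mult_left_mono) auto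
    finally show ?thesis
      using WL[OF uW] by (simp add: H_def algebra_simps)
  qed
  show ?thesis
  proof (intro exI conjI ballI allI impI)
    show "0 < K powr P * 2 powr e * B0 powr e" "0 < K powr P * 2 powr e * B1 powr e"
      using K B0 B1 by auto
  qed (use main in \<open>auto simp: e_def\<close>)
qed

end
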